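(* For any $1\le p<\infty$ and any $d\ge2$, the set $\mathcal{X}_d(R)$ is compact in $L^p(\Omega)$.
   Context: Let $d\ge2$, let $\Omega\subset\mathbb{R}^d$ be a nonempty bounded domain (open connected set) with $C^\infty$-smooth boundary, and let $\Omega'\subset\mathbb{R}^d$ be a domain with $\overline{\Omega'}\subset\Omega$. Fix $m>0$, $M\ge\max(1,m)$, $R>0$, $\alpha\in(0,1]$. Let $\Gamma=\{\gamma\in L^\infty(\Omega;\mathbb{R}): m\le\gamma\le M\text{ a.e. on }\Omega\}$ and $\Gamma'=\{\gamma\in\Gamma:\gamma=1\text{ a.e. on }\Omega\setminus\Omega'\}$. For $U\subseteq\mathbb{R}^d$ open, $V(v;U)=\sup\{\int_U v\,\nabla\cdot\phi\,dx:\phi\in C_c^\infty(U;\mathbb{R}^d),\|\phi\|_{L^\infty}\le1\}$, $\mathsf{BV}(U)=\{v\in L^1(U):V(v;U)<\infty\}$ and $\|v\|_{\mathsf{BV}}=\max(\|v\|_{L^1(U)},V(v;U))$. The $C^{1,\alpha}(\overline\Omega)$ norm is $\|v\|_{C^{1,\alpha}}=\max(\|v\|_{C^1},\max_{|\beta|=1}|\partial^\beta v|_{C^{0,\alpha}})$, where $\|v\|_{C^1}=\max_{|\beta|\le1}\sup_\Omega|\partial^\beta v|$ and $|v|_{C^{0,\alpha}}=\sup_{x\ne x'\in\Omega}|v(x)-v(x')|/|x-x'|^\alpha$. Set $\mathcal{X}_{\mathsf{BV}}(R)=\{\gamma\in\Gamma'\cap\mathsf{BV}(\Omega):\|\gamma\|_{\mathsf{BV}}\le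 R\}$, $\mathcal{X}_{C^{1,\alpha}}(R)=\{\gamma\in\Gamma'\cap C^{1,\alpha}(\overline\Omega):\|\gamma\|_{C^{1,\alpha}}\le R\}$, and $\mathcal{X}_d(R)=\mathcal{X}_{\mathsf{BV}}(R)$ if $d=2$, $\mathcal{X}_d(R)=\mathcal{X}_{C^{1,\alpha}}(R)$ if $d\ge3$. *)

theory Defs
  imports "HOL-Analysis.Analysis"
begin

text \<open>For open \<open>S\<close>, \<open>Ck_on k S f\<close> says that \<open>f\<close> is \<open>k\<close> times continuously differentiable
  on \<open>S\<close>; each step passes to all directional derivatives.\<close>

fun Ck_on :: "nat \<Rightarrow> 'a set \<Rightarrow> ('a::real_normed_vector \<Rightarrow> 'b::real_normed_vector) \<Rightarrow> bool" where
  "Ck_on 0 S f \<longleftrightarrow> continuous_on S f"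
| "Ck_on (Suc k) S f \<longleftrightarrow> (\<forall>x\<in>S. f differentiable (at x)) \<and>
     (\<forall>v. Ck_on k S (\<lambda>x. frechet_derivative f (at x) v))"

definition smooth_on :: "'a set \<Rightarrow> ('a::real_normed_vector \<Rightarrow> 'b::real_normed_vector) \<Rightarrow> bool" where
  "smooth_on S f \<longleftrightarrow> (\<forall>k. Ck_on k S f)"

text \<open>Near each boundary point, a smooth diffeomorphism \<open>\<psi>\<close> with smooth inverse \<open>\<psi>'\<close> straightens
  the boundary, sending the inside of \<open>U\<close> to a coordinate half-space (the definition of Gilbarg
  and Trudinger).\<close>

definition smooth_boundary :: "(real^'n) set \<Rightarrow> bool" where
  "smooth_boundary U \<longleftrightarrow> (\<forall>z\<in>frontier U. \<exists>B. \<exists>W::(real^'n) set. \<exists>\<psi> \<psi>'. \<exists>k::'n.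
     open B \<and> z \<in> B \<and> open W \<and> homeomorphism B W \<psi> \<psi>' \<and> smooth_on B \<psi> \<and> smooth_on W \<psi>' \<and>
     \<psi> ` (B \<inter> U) = {y\<in>W. 0 < y $ k} \<and> \<psi> ` (B \<inter> frontier U) = {y\<in>W. y $ k = 0})"

definition partial :: "'n::finite \<Rightarrow> (real^'n \<Rightarrow> 'b::real_normed_vector) \<Rightarrow> real^'n \<Rightarrow> 'b" where
  "partial i f x = frechet_derivative f (at x) (axis i 1)"

definition divergence :: "(real^'n \<Rightarrow> real^'n) \<Rightarrow> real^'n \<Rightarrow> real" where
  "divergence \<phi> x = (\<Sum>i\<in>UNIV. partial i \<phi> x $ i)"

text \<open>Members of \<open>Lp_space p U\<close> are classes of functions modulo equality almost everywhere on \<open>U\<close>.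
  A set \<open>X\<close> of functions on \<open>U\<close> gives the set \<open>X // ae_eq U\<close> of classes.\<close>

definition ae_eq :: "'a::euclidean_space set \<Rightarrow> (('a \<Rightarrow> real) \<times> ('a \<Rightarrow> real)) set" where
  "ae_eq U = {(f, g). f \<in> borel_measurable (lebesgue_on U) \<and> g \<in> borel_measurable (lebesgue_on U) \<and>
     (AE x in lebesgue_on U. f x = g x)}"

definition Lp_fun :: "real \<Rightarrow> 'a::euclidean_space set \<Rightarrow> ('a \<Rightarrow> real) set" where
  "Lp_fun p U = {f \<in> borel_measurable (lebesgue_on U). integrable (lebesgue_on U) (\<lambda>x. \<bar>f x\<bar> powr p)}"

definition Lp_norm :: "real \<Rightarrow> 'a::euclidean_space set \<Rightarrow> ('a \<Rightarrow> real) \<Rightarrow> real" where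
  "Lp_norm p U f = (\<integral>x. \<bar>f x\<bar> powr p \<partial>lebesgue_on U) powr (1 / p)"

definition Lp_space :: "real \<Rightarrow> 'a::euclidean_space set \<Rightarrow> ('a \<Rightarrow> real) set set" where
  "Lp_space p U = Lp_fun p U // ae_eq U"

text \<open>The choice of representatives does not matter: see \<open>Lp_dist_class\<close> below.\<close>

definition Lp_dist :: "real \<Rightarrow> 'a::euclidean_space set \<Rightarrow> ('a \<Rightarrow> real) set \<Rightarrow> ('a \<Rightarrow> real) set \<Rightarrow> real" where
  "Lp_dist p U F G = Lp_norm p U (\<lambda>x. (SOME f. f \<in> F) x - (SOME g. g \<in> G) x)"

definition Lp_topology :: "real \<Rightarrow> 'a::euclidean_space set \<Rightarrow> ('a \<Rightarrow> real) set topology" where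
  "Lp_topology p U = Metric_space.mtopology (Lp_space p U) (Lp_dist p U)"

definition Linf_fun :: "'a::euclidean_space set \<Rightarrow> ('a \<Rightarrow> real) set" where
  "Linf_fun U = {f \<in> borel_measurable (lebesgue_on U). \<exists>C. AE x in lebesgue_on U. \<bar>f x\<bar> \<le> C}"

definition test_fields :: "(real^'n) set \<Rightarrow> (real^'n \<Rightarrow> real^'n) set" where
  "test_fields U = {\<phi>. smooth_on UNIV \<phi> \<and>
     compact (closure {x. \<phi> x \<noteq> 0}) \<and> closure {x. \<phi> x \<noteq> 0} \<subseteq> U}"

definition variation :: "(real^'n) set \<Rightarrow> (real^'n \<Rightarrow> real) \<Rightarrow> ereal" where
  "variation U v = (SUP \<phi> \<in> {\<phi> \<in> test_fields U. AE x in lebesgue_on U. norm (\<phi> x) \<le> 1}.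
     ereal (\<integral>x. v x * divergence \<phi> x \<partial>lebesgue_on U))"

definition BV :: "(real^'n) set \<Rightarrow> (real^'n \<Rightarrow> real) set" where
  "BV U = {v. integrable (lebesgue_on U) v \<and> variation U v < \<infinity>}"

definition BV_norm :: "(real^'n) set \<Rightarrow> (real^'n \<Rightarrow> real) \<Rightarrow> ereal" where
  "BV_norm U v = max (ereal (\<integral>x. \<bar>v x\<bar> \<partial>lebesgue_on U)) (variation U v)"

definition extends_continuously :: "(real^'n) set \<Rightarrow> (real^'n \<Rightarrow> real) \<Rightarrow> bool" where
  "extends_continuously U v \<longleftrightarrow> (\<exists>w. continuous_on (closure U) w \<and> (\<forall>x\<in>U. w x = v x))"

definition C1_norm :: "(real^'n) set \<Rightarrow> (real^'n \<Rightarrow> real) \<Rightarrow> ereal" where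
  "C1_norm U v = max (SUP x\<in>U. ereal \<bar>v x\<bar>) (MAX i\<in>UNIV. SUP x\<in>U. ereal \<bar>partial i v x\<bar>)"

definition holder_seminorm :: "real \<Rightarrow> (real^'n) set \<Rightarrow> (real^'n \<Rightarrow> real) \<Rightarrow> ereal" where
  "holder_seminorm \<alpha> U v =
     (SUP (x, y) \<in> {(x, y). x \<in> U \<and> y \<in> U \<and> x \<noteq> y}. ereal (\<bar>v x - v y\<bar> / dist x y powr \<alpha>))"

definition C1_holder_norm :: "real \<Rightarrow> (real^'n) set \<Rightarrow> (real^'n \<Rightarrow> real) \<Rightarrow> ereal" where
  "C1_holder_norm \<alpha> U v = max (C1_norm U v) (MAX i\<in>UNIV. holder_seminorm \<alpha> U (partial i v))"

text \<open>The space of the closure of \<open>U\<close>: the function and its first partial derivatives on \<open>U\<close>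
  extend continuously to the closure.\<close>

definition C1_holder :: "real \<Rightarrow> (real^'n) set \<Rightarrow> (real^'n \<Rightarrow> real) set" where
  "C1_holder \<alpha> U = {v. Ck_on 1 U v \<and>
     extends_continuously U v \<and> (\<forall>i. extends_continuously U (partial i v)) \<and>
     C1_holder_norm \<alpha> U v < \<infinity>}"

definition Gam :: "real \<Rightarrow> real \<Rightarrow> (real^'n) set \<Rightarrow> (real^'n \<Rightarrow> real) set" where
  "Gam m M \<Omega> = {\<gamma> \<in> Linf_fun \<Omega>. AE x in lebesgue_on \<Omega>. m \<le> \<gamma> x \<and> \<gamma> x \<le> M}"

definition Gam' :: "real \<Rightarrow> real \<Rightarrow> (real^'n) set \<Rightarrow> (real^'n) set \<Rightarrow> (real^'n \<Rightarrow> real) set" where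
  "Gam' m M \<Omega> \<Omega>' = {\<gamma> \<in> Gam m M \<Omega>. AE x in lebesgue_on (\<Omega> - \<Omega>'). \<gamma> x = 1}"

definition X_BV :: "real \<Rightarrow> real \<Rightarrow> (real^'n) set \<Rightarrow> (real^'n) set \<Rightarrow> real \<Rightarrow> (real^'n \<Rightarrow> real) set" where
  "X_BV m M \<Omega> \<Omega>' R = {\<gamma> \<in> Gam' m M \<Omega> \<Omega>' \<inter> BV \<Omega>. BV_norm \<Omega> \<gamma> \<le> ereal R}"

definition X_C1 ::
  "real \<Rightarrow> real \<Rightarrow> real \<Rightarrow> (real^'n) set \<Rightarrow> (real^'n) set \<Rightarrow> real \<Rightarrow> (real^'n \<Rightarrow> real) set" where
  "X_C1 \<alpha> m M \<Omega> \<Omega>' R = {\<gamma> \<in> Gam' m M \<Omega> \<Omega>' \<inter> C1_holder \<alpha> \<Omega>. C1_holder_norm \<alpha> \<Omega> \<gamma> \<le> ereal R}"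

definition X_d ::
  "real \<Rightarrow> real \<Rightarrow> real \<Rightarrow> (real^'n) set \<Rightarrow> (real^'n) set \<Rightarrow> real \<Rightarrow> (real^'n \<Rightarrow> real) set" where
  "X_d \<alpha> m M \<Omega> \<Omega>' R = (if CARD('n) = 2 then X_BV m M \<Omega> \<Omega>' R else X_C1 \<alpha> m M \<Omega> \<Omega>' R)"

lemma equiv_ae_eq: "equiv (borel_measurable (lebesgue_on U)) (ae_eq U)"
proof (rule equivI)
  show "refl_on (borel_measurable (lebesgue_on U)) (ae_eq U)"
    by (auto simp: refl_on_def ae_eq_def)
  show "sym (ae_eq U)"
    unfolding sym_def ae_eq_def by (auto elim: eventually_mono)
  show "trans (ae_eq U)"
    unfolding trans_def ae_eq_def by (auto elim: eventually_elim2)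
  show "ae_eq U \<subseteq> borel_measurable (lebesgue_on U) \<times> borel_measurable (lebesgue_on U)"
    by (auto simp: ae_eq_def)
qed

lemma Lp_norm_nonneg: "0 \<le> Lp_norm p U f"
  by (simp add: Lp_norm_def)

lemma Lp_norm_cong_AE:
  assumes "f \<in> borel_measurable (lebesgue_on U)" "g \<in> borel_measurable (lebesgue_on U)"
    and "AE x in lebesgue_on U. f x = g x"
  shows "Lp_norm p U f = Lp_norm p U g"
proof -
  have "(\<integral>x. \<bar>f x\<bar> powr p \<partial>lebesgue_on U) = (\<integral>x. \<bar>g x\<bar> powr p \<partial>lebesgue_on U)"
    using assms by (intro integral_cong_AE) (auto elim: eventually_mono)
  then show ?thesis by (simp add: Lp_norm_def)
qed

lemma powr_abs_add_le:
  fixes x y a b p :: real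
  assumes p: "1 \<le> p" and ab: "0 < a" "0 < b"
  shows "\<bar>x + y\<bar> powr p \<le> (a + b) powr (p - 1) * (a powr (1 - p) * \<bar>x\<bar> powr p + b powr (1 - p) * \<bar>y\<bar> powr p)"
proof -
  define t where "t = a / (a + b)"
  have t: "0 < t" "t < 1" "1 - t = b / (a + b)" using ab by (auto simp: t_def field_simps)
  have scale: "s * (z / s) powr p = s powr (1 - p) * z powr p" if "0 < s" "0 \<le> z" for s z :: real
  proof -
    have "s powr (1 - p) = s / s powr p" using that by (simp add: powr_diff)
    then show ?thesis using that by (simp add: powr_divide)
  qed
  have sum: "(u + w) powr p \<le> t powr (1 - p) * u powr p + (1 - t) powr (1 - p) * w powr p"
    if uw: "0 \<le> u" "0 \<le> w" for u w :: real
  proof (cases "u = 0 \<or> w = 0")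
    case True
    have g: "1 \<le> s powr (1 - p)" if "0 < s" "s < 1" for s :: real
      using that p powr_mono'[of "1 - p" 0 s] by simp
    have "1 * u powr p \<le> t powr (1 - p) * u powr p"
      by (rule mult_right_mono) (use g t in auto)
    moreover have "1 * w powr p \<le> (1 - t) powr (1 - p) * w powr p"
      by (rule mult_right_mono) (use g t in auto)
    ultimately show ?thesis using True uw p by auto
  next
    case False
    then have pos: "0 < u / t" "0 < w / (1 - t)" using uw t(1,2) by auto
    have "((1 - (1 - t)) *\<^sub>R (u / t) + (1 - t) *\<^sub>R (w / (1 - t))) powr p
        \<le> (1 - (1 - t)) * (u / t) powr p + (1 - t) * (w / (1 - t)) powr p"
      by (rule convex_onD[OF powr_convex[OF p]]) (use t pos in auto)
    moreover have "(1 - (1 - t)) *\<^sub>R (u / t) + (1 - t) *\<^sub>R (w / (1 - t)) = u + w"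
      using t(1,2) by simp
    moreover have "t * (u / t) powr p = t powr (1 - p) * u powr p"
      using scale t(1) uw by blast
    moreover have "(1 - t) * (w / (1 - t)) powr p = (1 - t) powr (1 - p) * w powr p"
      by (rule scale) (use t(2) uw in auto)
    ultimately show ?thesis by simp
  qed
  have c: "(d / (a + b)) powr (1 - p) = (a + b) powr (p - 1) * d powr (1 - p)" if "0 < d" for d
  proof -
    have "(a + b) powr (p - 1) = inverse ((a + b) powr (1 - p))"
      by (metis minus_diff_eq powr_minus)
    then show ?thesis by (simp add: divide_inverse powr_mult inverse_powr)
  qed
  have "\<bar>x + y\<bar> powr p \<le> (\<bar>x\<bar> + \<bar>y\<bar>) powr p"
    using p by (intro powr_mono2) auto
  also have "\<dots> \<le> t powr (1 - p) * \<bar>x\<bar> powr p + (1 - t) powr (1 - p) * \<bar>y\<bar> powr p"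
    by (rule sum) auto
  also have "\<dots> = (a + b) powr (p - 1) * (a powr (1 - p) * \<bar>x\<bar> powr p + b powr (1 - p) * \<bar>y\<bar> powr p)"
    unfolding t(3) unfolding t_def by (simp only: c[OF ab(1)] c[OF ab(2)] distrib_left mult.assoc)
  finally show ?thesis .
qed

lemma Lp_fun_add:
  assumes p: "1 \<le> p" and f: "f \<in> Lp_fun p U" and g: "g \<in> Lp_fun p U"
  shows "(\<lambda>x. f x + g x) \<in> Lp_fun p U"
    and "Lp_norm p U (\<lambda>x. f x + g x) \<le> Lp_norm p U f + Lp_norm p U g"
proof -
  let ?L = "lebesgue_on U"
  have mf: "f \<in> borel_measurable ?L" "g \<in> borel_measurable ?L"
    and I: "integrable ?L (\<lambda>x. \<bar>f x\<bar> powr p)" "integrable ?L (\<lambda>x. \<bar>g x\<bar> powr p)"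
    using f g by (auto simp: Lp_fun_def)
  define B where "B a b = (\<lambda>x. (a + b) powr (p - 1) *
      (a powr (1 - p) * \<bar>f x\<bar> powr p + b powr (1 - p) * \<bar>g x\<bar> powr p))" for a b
  have IB: "integrable ?L (B a b)" for a b
    unfolding B_def using I by auto
  have le: "\<bar>f x + g x\<bar> powr p \<le> B a b x" if "0 < a" "0 < b" for a b x
    unfolding B_def by (rule powr_abs_add_le[OF p that])
  have IS: "integrable ?L (\<lambda>x. \<bar>f x + g x\<bar> powr p)"
  proof (rule Bochner_Integration.integrable_bound[OF IB[of 1 1]])
    show "(\<lambda>x. \<bar>f x + g x\<bar> powr p) \<in> borel_measurable ?L" using mf by auto
    have "\<bar>f x + g x\<bar> powr p \<le> \<bar>B 1 1 x\<bar>" for x using le[of 1 1 x] by linarith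
    then show "AE x in ?L. norm (\<bar>f x + g x\<bar> powr p) \<le> norm (B 1 1 x)" by simp
  qed
  show "(\<lambda>x. f x + g x) \<in> Lp_fun p U" using IS mf by (auto simp: Lp_fun_def)
  have *: "Lp_norm p U (\<lambda>x. f x + g x) \<le> a + b"
    if a: "Lp_norm p U f < a" and b: "Lp_norm p U g < b" for a b
  proof -
    have pos: "0 < a" "0 < b" using a b Lp_norm_nonneg[of p U f] Lp_norm_nonneg[of p U g] by linarith+
    have le_pow: "(\<integral>x. \<bar>h x\<bar> powr p \<partial>?L) \<le> c powr p" if "Lp_norm p U h < c" for h c
    proof -
      have "(\<integral>x. \<bar>h x\<bar> powr p \<partial>?L) = Lp_norm p U h powr p"
        using p by (simp add: Lp_norm_def powr_powr)
      also have "\<dots> \<le> c powr p" using that p Lp_norm_nonneg[of p U h] by (intro powr_mono2) auto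
      finally show ?thesis .
    qed
    have one: "c powr (1 - p) * c powr p = c" if "0 < c" for c :: real
      using that by (simp flip: powr_add)
    have "(\<integral>x. \<bar>f x + g x\<bar> powr p \<partial>?L) \<le> (\<integral>x. B a b x \<partial>?L)"
      by (rule integral_mono[OF IS IB]) (rule le[OF pos])
    also have "\<dots> = (a + b) powr (p - 1) * (a powr (1 - p) * (\<integral>x. \<bar>f x\<bar> powr p \<partial>?L)
        + b powr (1 - p) * (\<integral>x. \<bar>g x\<bar> powr p \<partial>?L))"
      unfolding B_def using I by simp
    also have "\<dots> \<le> (a + b) powr (p - 1) * (a powr (1 - p) * a powr p + b powr (1 - p) * b powr p)"
      by (intro mult_left_mono add_mono le_pow[OF a] le_pow[OF b]) auto
    also have "\<dots> = (a + b) powr (p - 1) * (a + b) powr 1"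
      using pos by (simp add: one)
    also have "\<dots> = (a + b) powr p"
      by (simp flip: powr_add del: powr_one')
    finally have "Lp_norm p U (\<lambda>x. f x + g x) \<le> ((a + b) powr p) powr (1 / p)"
      unfolding Lp_norm_def using p by (intro powr_mono2) auto
    also have "\<dots> = a + b" using p pos by (simp add: powr_powr)
    finally show ?thesis .
  qed
  show "Lp_norm p U (\<lambda>x. f x + g x) \<le> Lp_norm p U f + Lp_norm p U g"
  proof (rule field_le_epsilon)
    fix e :: real assume "0 < e"
    then show "Lp_norm p U (\<lambda>x. f x + g x) \<le> Lp_norm p U f + Lp_norm p U g + e"
      using *[of "Lp_norm p U f + e / 2" "Lp_norm p U g + e / 2"] by simp
  qed
qed

lemma Lp_fun_diff:
  assumes p: "1 \<le> p" and f: "f \<in> Lp_fun p U" and g: "g \<in> Lp_fun p U"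
  shows "(\<lambda>x. f x - g x) \<in> Lp_fun p U"
proof -
  have "(\<lambda>x. - g x) \<in> Lp_fun p U" using g by (auto simp: Lp_fun_def)
  from Lp_fun_add(1)[OF p f this] show ?thesis by simp
qed

lemma Lp_norm_eq_0_iff:
  assumes p: "1 \<le> p" and f: "f \<in> Lp_fun p U"
  shows "Lp_norm p U f = 0 \<longleftrightarrow> (AE x in lebesgue_on U. f x = 0)"
proof -
  have "Lp_norm p U f = 0 \<longleftrightarrow> (\<integral>x. \<bar>f x\<bar> powr p \<partial>lebesgue_on U) = 0"
    by (simp add: Lp_norm_def)
  also have "\<dots> \<longleftrightarrow> (AE x in lebesgue_on U. \<bar>f x\<bar> powr p = 0)"
    using f by (intro integral_nonneg_eq_0_iff_AE) (auto simp: Lp_fun_def)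
  finally show ?thesis by simp
qed

lemma Lp_space_rep:
  assumes F: "F \<in> Lp_space p U"
  shows "(SOME f. f \<in> F) \<in> Lp_fun p U" and "F = ae_eq U `` {SOME f. f \<in> F}"
proof -
  obtain f where f: "f \<in> Lp_fun p U" and Ff: "F = ae_eq U `` {f}"
    using F unfolding Lp_space_def by (auto elim!: quotientE)
  have "f \<in> F" using f Ff by (auto simp: ae_eq_def Lp_fun_def)
  then have "(SOME f. f \<in> F) \<in> F" by (rule someI[where P = "\<lambda>k. k \<in> _"])
  then have ae: "(f, SOME f. f \<in> F) \<in> ae_eq U" using Ff by simp
  define h where "h = (SOME f. f \<in> F)"
  have fh: "(f, h) \<in> ae_eq U" using ae by (simp add: h_def)
  have "integrable (lebesgue_on U) (\<lambda>x. \<bar>h x\<bar> powr p)"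
    by (rule integrable_cong_AE_imp[of _ "\<lambda>x. \<bar>f x\<bar> powr p"])
       (use f fh in \<open>auto simp: Lp_fun_def ae_eq_def elim: eventually_mono\<close>)
  then show "(SOME f. f \<in> F) \<in> Lp_fun p U"
    using fh unfolding h_def[symmetric] by (auto simp: Lp_fun_def ae_eq_def)
  show "F = ae_eq U `` {SOME f. f \<in> F}"
    using equiv_class_eq[OF equiv_ae_eq ae] Ff by (rule trans[rotated])
qed

lemma Lp_dist_class:
  assumes f: "f \<in> Lp_fun p U" and g: "g \<in> Lp_fun p U"
  shows "Lp_dist p U (ae_eq U `` {f}) (ae_eq U `` {g}) = Lp_norm p U (\<lambda>x. f x - g x)"
proof -
  have rep: "(h, SOME k. k \<in> ae_eq U `` {h}) \<in> ae_eq U" if "h \<in> Lp_fun p U" for h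
  proof -
    have "h \<in> ae_eq U `` {h}" using that by (auto simp: Lp_fun_def ae_eq_def)
    then have "(SOME k. k \<in> ae_eq U `` {h}) \<in> ae_eq U `` {h}" by (rule someI[where P = "\<lambda>k. k \<in> _"])
    then show ?thesis by simp
  qed
  show ?thesis
    unfolding Lp_dist_def
  proof (rule Lp_norm_cong_AE)
    show "AE x in lebesgue_on U. (SOME k. k \<in> ae_eq U `` {f}) x - (SOME k. k \<in> ae_eq U `` {g}) x = f x - g x"
      using rep[OF f] rep[OF g] unfolding ae_eq_def by (auto elim: eventually_elim2)
  qed (use rep[OF f] rep[OF g] in \<open>auto simp: ae_eq_def\<close>)
qed

theorem Metric_space_Lp:
  assumes p: "1 \<le> p"
  shows "Metric_space (Lp_space p U) (Lp_dist p U)"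
proof
  show "0 \<le> Lp_dist p U F G" for F G by (simp add: Lp_dist_def Lp_norm_nonneg)
  show "Lp_dist p U F G = Lp_dist p U G F" for F G
    by (simp add: Lp_dist_def Lp_norm_def abs_minus_commute)
next
  fix F G assume F: "F \<in> Lp_space p U" and G: "G \<in> Lp_space p U"
  define f g where "f = (SOME f. f \<in> F)" and "g = (SOME g. g \<in> G)"
  have fg: "f \<in> Lp_fun p U" "g \<in> Lp_fun p U" "F = ae_eq U `` {f}" "G = ae_eq U `` {g}"
    using Lp_space_rep[OF F] Lp_space_rep[OF G] by (auto simp: f_def g_def)
  have m: "f \<in> borel_measurable (lebesgue_on U)" "g \<in> borel_measurable (lebesgue_on U)"
    using fg by (auto simp: Lp_fun_def)
  have "Lp_dist p U F G = 0 \<longleftrightarrow> (AE x in lebesgue_on U. f x - g x = 0)"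
    unfolding Lp_dist_def f_def[symmetric] g_def[symmetric]
    by (rule Lp_norm_eq_0_iff[OF p Lp_fun_diff[OF p fg(1,2)]])
  also have "\<dots> \<longleftrightarrow> (f, g) \<in> ae_eq U" using m by (simp add: ae_eq_def)
  also have "\<dots> \<longleftrightarrow> F = G" unfolding fg(3,4) using eq_equiv_class_iff[OF equiv_ae_eq m] by simp
  finally show "Lp_dist p U F G = 0 \<longleftrightarrow> F = G" .
next
  fix F G H assume F: "F \<in> Lp_space p U" and G: "G \<in> Lp_space p U" and H: "H \<in> Lp_space p U"
  define f g h where "f = (SOME f. f \<in> F)" and "g = (SOME g. g \<in> G)" and "h = (SOME h. h \<in> H)"
  have r: "f \<in> Lp_fun p U" "g \<in> Lp_fun p U" "h \<in> Lp_fun p U"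
    using Lp_space_rep[OF F] Lp_space_rep[OF G] Lp_space_rep[OF H] by (auto simp: f_def g_def h_def)
  show "Lp_dist p U F H \<le> Lp_dist p U F G + Lp_dist p U G H"
    unfolding Lp_dist_def f_def[symmetric] g_def[symmetric] h_def[symmetric]
    using Lp_fun_add(2)[OF p Lp_fun_diff[OF p r(1,2)] Lp_fun_diff[OF p r(2,3)]] by simp
qed

end

theory Submission
  imports Defs "HOL-Complex_Analysis.Great_Picard"
begin

text \<open>All functions in question take values in \<open>[m, M]\<close> almost everywhere on a set of finite measure.
  By dominated convergence, compactness in \<open>L\<^sup>p\<close> therefore follows, for every finite \<open>p\<close>, once each
  sequence in the set has a subsequence that converges almost everywhere to a member of the set
  (\<open>AE_subsequences_imp_compactin_Lp\<close>). Moreover the functions are \<open>1\<close> off the compact subset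
  \<open>closure \<Omega>'\<close> of \<open>\<Omega>\<close>, so nothing happens near the boundary of \<open>\<Omega>\<close>.

  For \<open>BV\<close>, let \<open>w\<close> be \<open>\<gamma> - 1\<close>, extended by \<open>0\<close>. The variation bound \<open>R\<close> gives
  \<open>\<integral> \<bar>w x - w (z + x)\<bar> dx \<le> R \<bar>z\<bar>\<close> for small \<open>z\<close> (\<open>variation_imp_translation_L1_le\<close>): by duality the
  left side is a supremum of integrals of \<open>w (\<psi> - \<psi> (\<cdot> - z))\<close> over smooth \<open>\<psi>\<close> with
  \<open>\<bar>\<psi>\<bar> \<le> 1\<close> and compact support near \<open>closure \<Omega>'\<close>, and
  \<open>\<psi> - \<psi> (\<cdot> - z)\<close> is the divergence of the field \<open>\<integral>\<^sub>0\<^sup>1 \<psi> (\<cdot> - t z) z dt\<close>, whose length is at most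
  \<open>\<bar>z\<bar>\<close>. An estimate of this kind that is uniform along a sequence yields an almost everywhere
  convergent subsequence (\<open>translation_bound_imp_AE_Cauchy_subsequence\<close>): local means are close to the
  functions in \<open>L\<^sup>1\<close>, and Arzela--Ascoli applies to the means. The limit stays in the set because the
  variation is lower semicontinuous (\<open>BV_norm_AE_limit\<close>).

  For \<open>C\<^sup>1\<^sup>,\<^sup>\<alpha>\<close>, Arzela--Ascoli applies to the functions together with their gradients on
  \<open>closure \<Omega>'\<close>; uniform convergence of both makes the limit differentiable with the right gradient, and
  the bounds pass to the limit pointwise (\<open>X_C1_AE_convergent_subsequence\<close>).\<close>

section \<open>Functions of class C^k on the whole space\<close>

lemma Ck_on_UNIV_Suc_has_derivativeI:
  assumes "\<And>x. (f has_derivative f' x) (at x)" and "\<And>v. Ck_on k UNIV (\<lambda>x. f' x v)"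
  shows "Ck_on (Suc k) UNIV f"
proof -
  have "frechet_derivative f (at x) = f' x" for x
    using frechet_derivative_at[OF assms(1)] by simp
  then show ?thesis
    using assms by (auto simp: differentiable_def)
qed

lemma Ck_on_UNIV_SucD:
  assumes "Ck_on (Suc k) UNIV f"
  shows "(f has_derivative frechet_derivative f (at x)) (at x)"
    and "Ck_on k UNIV (\<lambda>x. frechet_derivative f (at x) v)"
  using assms by (auto simp: frechet_derivative_works)

lemma Ck_on_UNIV_antimono_Suc: "Ck_on (Suc k) UNIV f \<Longrightarrow> Ck_on k UNIV f"
proof (induction k arbitrary: f)
  case 0
  then show ?case
    by (auto intro!: continuous_at_imp_continuous_on differentiable_imp_continuous_within)
next
  case (Suc k)
  show ?case
    using Suc.prems Suc.IH[of "\<lambda>x. frechet_derivative f (at x) v" for v]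
    by (metis Ck_on.simps(2))
qed

lemma Ck_on_UNIV_const: "Ck_on k UNIV (\<lambda>x. c)"
proof (induction k arbitrary: c)
  case (Suc k)
  show ?case
    by (rule Ck_on_UNIV_Suc_has_derivativeI[where f' = "\<lambda>x v. 0"]) (auto intro: Suc)
qed simp

lemma Ck_on_UNIV_bounded_linear:
  assumes "bounded_linear f"
  shows "Ck_on k UNIV f"
proof (cases k)
  case 0
  then show ?thesis
    using assms by (simp add: linear_continuous_on)
next
  case (Suc l)
  show ?thesis
    unfolding Suc
    by (rule Ck_on_UNIV_Suc_has_derivativeI[where f' = "\<lambda>x. f"])
       (use assms in \<open>auto intro: bounded_linear_imp_has_derivative Ck_on_UNIV_const\<close>)
qed

lemma Ck_on_UNIV_add:
  "Ck_on k UNIV f \<Longrightarrow> Ck_on k UNIV g \<Longrightarrow> Ck_on k UNIV (\<lambda>x. f x + g x)"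
proof (induction k arbitrary: f g)
  case 0
  then show ?case by (auto intro: continuous_intros)
next
  case (Suc k)
  show ?case
    by (rule Ck_on_UNIV_Suc_has_derivativeI[OF has_derivative_add[OF Ck_on_UNIV_SucD(1)[OF Suc.prems(1)]
        Ck_on_UNIV_SucD(1)[OF Suc.prems(2)]]])
       (intro Suc.IH Ck_on_UNIV_SucD(2)[OF Suc.prems(1)] Ck_on_UNIV_SucD(2)[OF Suc.prems(2)])
qed

lemma Ck_on_UNIV_scaleR:
  fixes f :: "'a::real_normed_vector \<Rightarrow> real"
  shows "Ck_on k UNIV f \<Longrightarrow> Ck_on k UNIV g \<Longrightarrow> Ck_on k UNIV (\<lambda>x. f x *\<^sub>R g x)"
proof (induction k arbitrary: f g)
  case 0
  then show ?case by (auto intro: continuous_intros)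
next
  case (Suc k)
  show ?case
    by (rule Ck_on_UNIV_Suc_has_derivativeI[OF has_derivative_scaleR[OF Ck_on_UNIV_SucD(1)[OF Suc.prems(1)]
        Ck_on_UNIV_SucD(1)[OF Suc.prems(2)]]])
       (intro Ck_on_UNIV_add Suc.IH Ck_on_UNIV_SucD(2)[OF Suc.prems(1)]
          Ck_on_UNIV_SucD(2)[OF Suc.prems(2)] Ck_on_UNIV_antimono_Suc[OF Suc.prems(1)]
          Ck_on_UNIV_antimono_Suc[OF Suc.prems(2)])
qed

lemma Ck_on_UNIV_mult:
  fixes f g :: "'a::real_normed_vector \<Rightarrow> real"
  shows "Ck_on k UNIV f \<Longrightarrow> Ck_on k UNIV g \<Longrightarrow> Ck_on k UNIV (\<lambda>x. f x * g x)"
  using Ck_on_UNIV_scaleR[of k f g] by simp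

lemma Ck_on_UNIV_sum:
  "(\<And>i. i \<in> I \<Longrightarrow> Ck_on k UNIV (f i)) \<Longrightarrow> Ck_on k UNIV (\<lambda>x. \<Sum>i\<in>I. f i x)"
  by (induction I rule: infinite_finite_induct) (auto intro: Ck_on_UNIV_const Ck_on_UNIV_add)

lemma Ck_on_UNIV_translate:
  "Ck_on k UNIV f \<Longrightarrow> Ck_on k UNIV (\<lambda>x. f (x - a))"
proof (induction k arbitrary: f)
  case 0
  then show ?case
    by (auto intro!: continuous_intros intro: continuous_on_compose2[of UNIV f])
next
  case (Suc k)
  have "((\<lambda>x. f (x - a)) has_derivative frechet_derivative f (at (x - a))) (at x)" for x
  proof -
    have "((\<lambda>x. x - a) has_derivative (\<lambda>v. v)) (at x)"
      by (auto intro!: derivative_eq_intros)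
    from has_derivative_compose[OF this Ck_on_UNIV_SucD(1)[OF Suc.prems]] show ?thesis .
  qed
  then show ?case
    by (rule Ck_on_UNIV_Suc_has_derivativeI) (rule Suc.IH[OF Ck_on_UNIV_SucD(2)[OF Suc.prems]])
qed

lemma Ck_on_UNIV_real_polynomial_function:
  "real_polynomial_function q \<Longrightarrow> Ck_on k UNIV q"
  by (induction q rule: real_polynomial_function.induct)
     (auto intro: Ck_on_UNIV_bounded_linear Ck_on_UNIV_const Ck_on_UNIV_add Ck_on_UNIV_mult)

section \<open>Smooth approximation with compact support\<close>

text \<open>The functions \<open>t \<mapsto> P(1/t) exp(-1/t)\<close>, extended by \<open>0\<close> to \<open>t \<le> 0\<close>, where \<open>P\<close> is a
  polynomial: a family that is closed under differentiation.\<close>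

definition flat :: "real poly \<Rightarrow> real \<Rightarrow> real" where
  "flat P t = (if 0 < t then poly P (1 / t) * exp (- (1 / t)) else 0)"

lemma flat_tendsto_0: "(flat P \<longlongrightarrow> 0) (at 0)"
proof (rule filterlim_split_at)
  have "((\<lambda>s. \<Sum>i\<le>degree P. coeff P i * (s ^ i / exp s)) \<longlongrightarrow> (\<Sum>i\<le>degree P. coeff P i * 0)) at_top"
    by (intro tendsto_intros tendsto_power_div_exp_0)
  then have "((\<lambda>s. poly P s * exp (- s)) \<longlongrightarrow> 0) at_top"
    by (simp add: poly_altdef sum_distrib_right exp_minus divide_inverse mult.assoc)
  then have "((\<lambda>t. poly P (inverse t) * exp (- inverse t)) \<longlongrightarrow> 0) (at_right 0)"
    using filterlim_compose filterlim_inverse_at_top_right by blast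
  moreover have "\<forall>\<^sub>F t in at_right 0. flat P t = poly P (inverse t) * exp (- inverse t)"
    by (auto simp: flat_def eventually_at_filter divide_inverse)
  ultimately show "(flat P \<longlongrightarrow> 0) (at_right 0)"
    using tendsto_cong by fast
  have "\<forall>\<^sub>F t in at_left 0. flat P t = 0"
    by (auto simp: flat_def eventually_at_filter)
  then show "(flat P \<longlongrightarrow> 0) (at_left 0)"
    by (rule tendsto_eventually)
qed

lemma flat_has_real_derivative:
  "(flat P has_real_derivative flat (pCons 0 (pCons 0 (P - pderiv P))) t) (at t)"
proof -
  consider "0 < t" | "t < 0" | "t = 0" by linarith
  then show ?thesis
  proof cases
    case 1
    have "((\<lambda>t. poly P (1 / t) * exp (- (1 / t))) has_real_derivative
        flat (pCons 0 (pCons 0 (P - pderiv P))) t) (at t)"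
      using 1 by (auto intro!: derivative_eq_intros simp: flat_def field_simps power2_eq_square)
    then show ?thesis
      by (rule has_field_derivative_transform_within_open[of _ _ _ "{0<..}"])
         (use 1 in \<open>auto simp: flat_def\<close>)
  next
    case 2
    have "((\<lambda>t. 0) has_real_derivative flat (pCons 0 (pCons 0 (P - pderiv P))) t) (at t)"
      using 2 by (auto simp: flat_def)
    then show ?thesis
      by (rule has_field_derivative_transform_within_open[of _ _ _ "{..<0}"])
         (use 2 in \<open>auto simp: flat_def\<close>)
  next
    case 3
    have "(flat P (0 + h) - flat P 0) / h = flat (pCons 0 P) h" for h
      by (auto simp: flat_def)
    then show ?thesis
      using 3 flat_tendsto_0[of "pCons 0 P"] by (simp add: DERIV_def) (simp add: flat_def[of _ 0])
  qed
qed

lemma Ck_on_UNIV_flat_compose: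
  assumes "real_polynomial_function q"
  shows "Ck_on k UNIV (\<lambda>x. flat P (q x))"
proof (induction k arbitrary: P)
  case 0
  have "isCont (flat P) t" for t
    using DERIV_isCont flat_has_real_derivative by blast
  then show ?case
    using continuous_on_compose2[of UNIV "flat P" UNIV q]
      continuous_on_polymonial_function[of q UNIV] assms
    by (auto simp: real_polynomial_function_eq continuous_at_imp_continuous_on)
next
  case (Suc k)
  let ?Q = "pCons 0 (pCons 0 (P - pderiv P))"
  have q: "Ck_on (Suc k) UNIV q"
    using assms by (rule Ck_on_UNIV_real_polynomial_function)
  have "((\<lambda>x. flat P (q x)) has_derivative
      (\<lambda>v. frechet_derivative q (at x) v * flat ?Q (q x))) (at x)" for x
    using DERIV_compose_FDERIV[OF flat_has_real_derivative Ck_on_UNIV_SucD(1)[OF q]] .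
  then show ?case
    by (rule Ck_on_UNIV_Suc_has_derivativeI)
       (intro Ck_on_UNIV_mult Suc.IH Ck_on_UNIV_SucD(2)[OF q])
qed

text \<open>The bump is \<open>exp (-1/t)\<close> evaluated at \<open>t = r\<^sup>2 - \<bar>x - a\<bar>\<^sup>2\<close>.\<close>

lemma smooth_bump_ball:
  fixes a :: "'a::euclidean_space"
  assumes "0 < r"
  obtains b :: "'a \<Rightarrow> real" where "smooth_on UNIV b" "\<And>x. 0 \<le> b x" "\<And>x. b x > 0 \<longleftrightarrow> x \<in> ball a r"
proof
  have "real_polynomial_function (\<lambda>x::'a. r\<^sup>2 - (norm (x - a))\<^sup>2)"
  proof -
    have "real_polynomial_function (\<lambda>x::'a. (x - a) \<bullet> i)" for i
      unfolding inner_diff_left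
      by (rule real_polynomial_function_diff[OF real_polynomial_function.intros(1)
            real_polynomial_function.intros(2)])
         (rule bounded_linear_inner_left)
    then have "real_polynomial_function (\<lambda>x::'a. (\<Sum>i\<in>Basis. ((x - a) \<bullet> i)\<^sup>2))"
      by (intro real_polynomial_function_sum real_polynomial_function_power) auto
    moreover have "(norm (x - a))\<^sup>2 = (\<Sum>i\<in>Basis. ((x - a) \<bullet> i)\<^sup>2)" for x
      by (simp add: norm_eq_sqrt_inner euclidean_inner[of "x - a" "x - a"] power2_eq_square sum_nonneg)
    ultimately have "real_polynomial_function (\<lambda>x. (norm (x - a))\<^sup>2)"
      by presburger
    then show ?thesis
      by (rule real_polynomial_function_diff[OF real_polynomial_function.intros(2)])
  qed
  then show "smooth_on UNIV (\<lambda>x. flat 1 (r\<^sup>2 - (norm (x - a))\<^sup>2))"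
    by (auto simp: smooth_on_def intro: Ck_on_UNIV_flat_compose)
  show "0 \<le> flat 1 (r\<^sup>2 - (norm (x - a))\<^sup>2)" for x
    by (simp add: flat_def)
  have "(norm (x - a))\<^sup>2 < r\<^sup>2 \<longleftrightarrow> norm (x - a) < r" for x
  proof
    show "norm (x - a) < r" if "(norm (x - a))\<^sup>2 < r\<^sup>2"
      using power2_less_imp_less[OF that] assms by simp
    show "(norm (x - a))\<^sup>2 < r\<^sup>2" if "norm (x - a) < r"
      using that by (rule power_strict_mono) auto
  qed
  then show "flat 1 (r\<^sup>2 - (norm (x - a))\<^sup>2) > 0 \<longleftrightarrow> x \<in> ball a r" for x
    by (simp add: flat_def dist_norm norm_minus_commute[of a x])
qed

text \<open>The approximant is \<open>cut * q\<close>, where \<open>cut\<close> is a sum of bumps that is positive on \<open>K\<close>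
  and \<open>q\<close> is a polynomial close to \<open>g / cut\<close>.\<close>

lemma smooth_approximation_compact_support:
  fixes g :: "'a::euclidean_space \<Rightarrow> real"
  assumes K: "compact K" and N: "open N" "K \<subseteq> N"
    and g: "continuous_on UNIV g" "\<And>x. x \<notin> K \<Longrightarrow> g x = 0" and e: "0 < e"
  obtains \<psi> T where "smooth_on UNIV \<psi>" "compact T" "T \<subseteq> N" "\<And>x. x \<notin> T \<Longrightarrow> \<psi> x = 0"
    "\<And>x. \<bar>\<psi> x - g x\<bar> \<le> e"
proof -
  have "\<exists>r>0. cball x r \<subseteq> N" if "x \<in> K" for x
    using that N open_contains_cball by blast
  then obtain r where r: "\<And>x. x \<in> K \<Longrightarrow> 0 < r x" "\<And>x. x \<in> K \<Longrightarrow> cball x (r x) \<subseteq> N"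
    by metis
  obtain D where D: "D \<subseteq> K" "finite D" "K \<subseteq> (\<Union>x\<in>D. ball x (r x))"
    by (rule compactE_image[OF K, of K "\<lambda>x. ball x (r x)"]) (use r in auto)
  have "\<exists>b::'a \<Rightarrow> real. smooth_on UNIV b \<and> (\<forall>x. 0 \<le> b x) \<and> (\<forall>x. b x > 0 \<longleftrightarrow> x \<in> ball a (r a))"
    if "a \<in> D" for a
    using smooth_bump_ball[of "r a" a] r(1) D(1) that by (metis subsetD)
  then have "\<exists>b. \<forall>a\<in>D. smooth_on UNIV (b a) \<and> (\<forall>x. 0 \<le> b a x) \<and> (\<forall>x. (b a x :: real) > 0 \<longleftrightarrow> x \<in> ball a (r a))"
    by (intro bchoice ballI)
  then obtain b :: "'a \<Rightarrow> 'a \<Rightarrow> real" where b: "\<And>a. a \<in> D \<Longrightarrow> smooth_on UNIV (b a)" "\<And>a x. a \<in> D \<Longrightarrow> 0 \<le> b a x"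
      "\<And>a x. a \<in> D \<Longrightarrow> b a x > 0 \<longleftrightarrow> x \<in> ball a (r a)"
    by blast
  define cut where "cut x = (\<Sum>a\<in>D. b a x)" for x
  define T where "T = (\<Union>a\<in>D. cball a (r a))"
  have smooth: "Ck_on k UNIV cut" for k
    unfolding cut_def using b(1) by (intro Ck_on_UNIV_sum) (auto simp: smooth_on_def)
  have cont: "continuous_on UNIV cut"
    using smooth[of 0] by simp
  have pos: "0 < cut x" if xK: "x \<in> K" for x
  proof -
    obtain a where "a \<in> D" "x \<in> ball a (r a)" using subsetD[OF D(3) xK] by blast
    then show ?thesis
      unfolding cut_def using b D(2) by (intro sum_pos2[of D a]) auto
  qed
  have T: "compact T" "T \<subseteq> N"
    using D(1,2) r(2) by (auto simp: T_def)
  have zero: "cut x = 0" if "x \<notin> T" for x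
  proof -
    have "b a x = 0" if "a \<in> D" for a
      using b(2,3)[OF that, of x] that \<open>x \<notin> T\<close> by (force simp: T_def)
    then show ?thesis by (simp add: cut_def)
  qed
  \<comment> \<open>\<open>u = g / cut\<close> is continuous everywhere: where \<open>cut\<close> is positive it is a quotient, and \<open>g\<close>
    vanishes on the open complement of \<open>K\<close>. These two open sets cover the space.\<close>
  define u where "u x = (if x \<in> K then g x / cut x else 0)" for x
  have u: "continuous_on UNIV u"
  proof -
    have o: "open {x. 0 < cut x}"
      using cont by (intro open_Collect_less) auto
    have "continuous_on {x. 0 < cut x} (\<lambda>x. g x / cut x)"
      by (intro continuous_intros continuous_on_subset[OF g(1)] continuous_on_subset[OF cont]) auto
    moreover have "u x = g x / cut x" for x
      using g(2) by (auto simp: u_def)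
    ultimately have "continuous_on {x. 0 < cut x} u"
      by (metis (no_types, lifting) continuous_on_cong)
    moreover have "continuous_on (- K) u"
      by (rule continuous_on_eq[of _ "\<lambda>x. 0"]) (auto simp: u_def)
    ultimately have "continuous_on ({x. 0 < cut x} \<union> - K) u"
      using o K by (intro continuous_on_open_Un) (auto simp: compact_imp_closed open_Compl)
    moreover have "{x. 0 < cut x} \<union> - K = UNIV"
      using pos by auto
    ultimately show ?thesis by simp
  qed
  have "bounded (cut ` T)"
    by (intro compact_imp_bounded compact_continuous_image T continuous_on_subset[OF cont]) auto
  then obtain B where B: "0 < B" "\<And>x. x \<in> T \<Longrightarrow> \<bar>cut x\<bar> \<le> B"
    by (auto simp: bounded_pos)
  obtain q where q: "real_polynomial_function q" "\<And>x. x \<in> T \<Longrightarrow> \<bar>u x - q x\<bar> < e / B"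
    using Stone_Weierstrass_real_polynomial_function[OF T(1) continuous_on_subset[OF u]] e B(1)
    by (metis divide_pos_pos subset_UNIV)
  show ?thesis
  proof
    show "smooth_on UNIV (\<lambda>x. cut x * q x)"
      unfolding smooth_on_def
      by (intro allI Ck_on_UNIV_mult smooth Ck_on_UNIV_real_polynomial_function q)
    show "compact T" "T \<subseteq> N" by fact+
    show "cut x * q x = 0" if "x \<notin> T" for x
      using zero[OF that] by simp
    show "\<bar>cut x * q x - g x\<bar> \<le> e" for x
    proof (cases "x \<in> T")
      case True
      have "g x = cut x * u x"
        using pos[of x] g(2)[of x] by (auto simp: u_def)
      then have "\<bar>cut x * q x - g x\<bar> = \<bar>cut x\<bar> * \<bar>u x - q x\<bar>"
        by (metis abs_minus_commute abs_mult right_diff_distrib)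
      also have "\<dots> \<le> B * (e / B)"
        using B(2)[OF True] q(2)[OF True] B(1) by (intro mult_mono) auto
      finally show ?thesis using B(1) by simp
    next
      case False
      then have "g x = 0"
        using zero[OF False] pos[of x] g(2)[of x] by force
      then show ?thesis using zero[OF False] e by simp
    qed
  qed
qed

section \<open>Differences of translates as divergences\<close>

lemma smooth_on_UNIV_has_derivative:
  "smooth_on UNIV \<psi> \<Longrightarrow> (\<psi> has_derivative frechet_derivative \<psi> (at x)) (at x)"
  unfolding smooth_on_def by (rule Ck_on_UNIV_SucD(1)[of 0]) blast

lemma smooth_on_UNIV_continuous_frechet_derivative:
  assumes "smooth_on UNIV \<psi>"
  shows "continuous_on UNIV (\<lambda>x. frechet_derivative \<psi> (at x) v)"
proof -
  have "Ck_on (Suc 0) UNIV \<psi>" using assms unfolding smooth_on_def by blast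
  then show ?thesis using Ck_on_UNIV_SucD(2)[of 0 \<psi> v] by simp
qed

lemma smooth_on_UNIV_continuous:
  assumes "smooth_on UNIV \<psi>"
  shows "continuous_on UNIV \<psi>"
proof -
  have "Ck_on 0 UNIV \<psi>" using assms unfolding smooth_on_def by blast
  then show ?thesis by simp
qed

lemma linear_eq_sum_axis:
  fixes f :: "real^'n \<Rightarrow> real"
  assumes "linear f"
  shows "f u = (\<Sum>i\<in>UNIV. u $ i * f (axis i 1))"
proof -
  have "f u = f (\<Sum>i\<in>UNIV. (u $ i) *\<^sub>R axis i 1)"
    by (simp add: basis_expansion flip: scalar_mult_eq_scaleR)
  also have "\<dots> = (\<Sum>i\<in>UNIV. u $ i * f (axis i 1))"
    by (simp add: linear_sum[OF assms] linear_scale[OF assms])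
  finally show ?thesis .
qed

lemma divergence_has_derivative:
  assumes "(\<phi> has_derivative \<phi>') (at x)"
  shows "divergence \<phi> x = (\<Sum>i\<in>UNIV. \<phi>' (axis i 1) $ i)"
  using frechet_derivative_at[OF assms] by (simp add: divergence_def partial_def)

lemma divergence_scaleR_const:
  fixes f :: "real^'n \<Rightarrow> real"
  assumes "(f has_derivative f') (at x)"
  shows "divergence (\<lambda>x. f x *\<^sub>R z) x = f' z"
proof -
  have "((\<lambda>x. f x *\<^sub>R z) has_derivative (\<lambda>v. f' v *\<^sub>R z)) (at x)"
    using assms by (auto intro!: derivative_eq_intros)
  then have "divergence (\<lambda>x. f x *\<^sub>R z) x = (\<Sum>i\<in>UNIV. z $ i * f' (axis i 1))"
    by (simp add: divergence_has_derivative mult.commute)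
  then show ?thesis
    using linear_eq_sum_axis[OF has_derivative_linear[OF assms], of z] by simp
qed

text \<open>A Riemann sum for \<open>\<integral>\<^sub>0\<^sup>1 \<psi>(x - t z) a z dt\<close>, a field whose divergence at \<open>x\<close> is
  \<open>a (\<psi> x - \<psi> (x - z))\<close>. The sum is used instead of the integral because its smoothness is immediate.\<close>

definition riemann_field :: "nat \<Rightarrow> real \<Rightarrow> real^'n \<Rightarrow> (real^'n \<Rightarrow> real) \<Rightarrow> real^'n \<Rightarrow> real^'n" where
  "riemann_field N a z \<psi> x = (\<Sum>j<N. \<psi> (x - (real j / real N) *\<^sub>R z)) *\<^sub>R ((a / real N) *\<^sub>R z)"

lemma smooth_riemann_field: "smooth_on UNIV \<psi> \<Longrightarrow> smooth_on UNIV (riemann_field N a z \<psi>)"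
  unfolding smooth_on_def riemann_field_def
  by (intro allI impI Ck_on_UNIV_scaleR[OF _ Ck_on_UNIV_const] Ck_on_UNIV_sum)
     (simp add: Ck_on_UNIV_translate)

lemma divergence_riemann_field:
  assumes "smooth_on UNIV \<psi>"
  shows "divergence (riemann_field N a z \<psi>) x =
    a * (\<Sum>j<N. frechet_derivative \<psi> (at (x - (real j / real N) *\<^sub>R z)) z) / real N"
proof -
  have d: "(\<psi> has_derivative frechet_derivative \<psi> (at y)) (at y)" for y
    using assms by (rule smooth_on_UNIV_has_derivative)
  have "((\<lambda>x. \<psi> (x - c)) has_derivative frechet_derivative \<psi> (at (x - c))) (at x)" for c
  proof -
    have "((\<lambda>x. x - c) has_derivative (\<lambda>v. v)) (at x)"
      by (auto intro!: derivative_eq_intros)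
    from has_derivative_compose[OF this d] show ?thesis .
  qed
  then have "((\<lambda>x. \<Sum>j<N. \<psi> (x - (real j / real N) *\<^sub>R z)) has_derivative
      (\<lambda>v. \<Sum>j<N. frechet_derivative \<psi> (at (x - (real j / real N) *\<^sub>R z)) v)) (at x)"
    by (intro has_derivative_sum)
  from divergence_scaleR_const[OF this]
  have "divergence (riemann_field N a z \<psi>) x =
      (\<Sum>j<N. frechet_derivative \<psi> (at (x - (real j / real N) *\<^sub>R z)) ((a / real N) *\<^sub>R z))"
    unfolding riemann_field_def[abs_def] .
  also have "\<dots> = (\<Sum>j<N. (a / real N) * frechet_derivative \<psi> (at (x - (real j / real N) *\<^sub>R z)) z)"
    using linear_scale[OF has_derivative_linear[OF d]] by simp
  finally show ?thesis
    by (simp add: sum_distrib_left sum_divide_distrib)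
qed

lemma continuous_on_divergence_riemann_field:
  assumes "smooth_on UNIV \<psi>"
  shows "continuous_on UNIV (divergence (riemann_field N a z \<psi>))"
proof -
  have "continuous_on UNIV (\<lambda>x. frechet_derivative \<psi> (at x) z)"
    using assms by (rule smooth_on_UNIV_continuous_frechet_derivative)
  then have *: "continuous_on UNIV (\<lambda>x. frechet_derivative \<psi> (at (x - c)) z)" for c
    by (rule continuous_on_compose2) (auto intro!: continuous_on_diff continuous_on_id continuous_on_const)
  have "continuous_on UNIV
      (\<lambda>x. (a / real N) * (\<Sum>j<N. frechet_derivative \<psi> (at (x - (real j / real N) *\<^sub>R z)) z))"
    by (intro continuous_on_mult continuous_on_sum continuous_on_const *)
  then show ?thesis
    by (simp add: divergence_riemann_field[OF assms, abs_def])
qed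

lemma divergence_riemann_field_approx:
  fixes \<psi> :: "real^'n \<Rightarrow> real"
  assumes \<psi>: "smooth_on UNIV \<psi>" and "bounded U" and e: "0 < e"
  shows "\<exists>N>0. \<forall>x\<in>U. \<bar>divergence (riemann_field N a z \<psi>) x - a * (\<psi> x - \<psi> (x - z))\<bar> \<le> \<bar>a\<bar> * e"
proof -
  let ?D = "\<lambda>y. frechet_derivative \<psi> (at y) z"
  obtain r where r: "\<And>x. x \<in> U \<Longrightarrow> norm x \<le> r"
    using \<open>bounded U\<close> by (auto simp: bounded_iff)
  have "continuous_on UNIV ?D"
    using \<psi> by (rule smooth_on_UNIV_continuous_frechet_derivative)
  then have "uniformly_continuous_on (cball 0 (r + norm z)) ?D"
    by (intro compact_uniformly_continuous) (auto intro: continuous_on_subset)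
  then obtain d where d: "0 < d" "\<And>y y'. y \<in> cball 0 (r + norm z) \<Longrightarrow> y' \<in> cball 0 (r + norm z) \<Longrightarrow>
      dist y' y < d \<Longrightarrow> dist (?D y') (?D y) < e"
    using e unfolding uniformly_continuous_on_def by metis
  obtain N where N: "0 < N" "norm z / real N < d"
  proof -
    obtain n :: nat where "norm z / d < real n" using reals_Archimedean2 by blast
    then have "norm z < d * real n" using d(1) by (simp add: pos_divide_less_eq mult.commute)
    then have "norm z < d * real (Suc n)" using d(1) by (simp add: algebra_simps)
    then show ?thesis using that[of "Suc n"] by (simp add: pos_divide_less_eq)
  qed
  have "\<bar>divergence (riemann_field N a z \<psi>) x - a * (\<psi> x - \<psi> (x - z))\<bar> \<le> \<bar>a\<bar> * e" if x: "x \<in> U" for x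
  proof -
    define g where "g t = \<psi> (x - t *\<^sub>R z)" for t
    have g': "(g has_real_derivative - ?D (x - t *\<^sub>R z)) (at t)" for t
    proof -
      have d\<psi>: "(\<psi> has_derivative frechet_derivative \<psi> (at y)) (at y)" for y
        using \<psi> by (rule smooth_on_UNIV_has_derivative)
      have "((\<lambda>t. x - t *\<^sub>R z) has_derivative (\<lambda>s. - (s *\<^sub>R z))) (at t)"
        by (auto intro!: derivative_eq_intros)
      from has_derivative_compose[OF this d\<psi>]
      have "(g has_derivative (\<lambda>s. frechet_derivative \<psi> (at (x - t *\<^sub>R z)) (- (s *\<^sub>R z)))) (at t)"
        by (simp add: g_def[abs_def])
      then show ?thesis
        using linear_scale[OF has_derivative_linear[OF d\<psi>]] linear_neg[OF has_derivative_linear[OF d\<psi>]]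
        unfolding has_field_derivative_def
        by (elim has_derivative_eq_rhs) (simp add: fun_eq_iff)
    qed
    \<comment> \<open>On each of the \<open>N\<close> pieces the mean value theorem replaces the increment of \<open>g\<close> by a value
      of \<open>?D\<close> at a point closer than \<open>d\<close> to the node.\<close>
    have step: "\<bar>?D (x - (real j / real N) *\<^sub>R z) / real N - (g (real j / real N) - g (real (Suc j) / real N))\<bar>
        \<le> e / real N" if j: "j < N" for j
    proof -
      have less: "real j / real N < real (Suc j) / real N"
        using N(1) by (simp add: divide_strict_right_mono)
      obtain \<xi> where \<xi>: "real j / real N < \<xi>" "\<xi> < real (Suc j) / real N"
        "g (real (Suc j) / real N) - g (real j / real N) =
          (real (Suc j) / real N - real j / real N) * - ?D (x - \<xi> *\<^sub>R z)"
        using MVT2[OF less, of g "\<lambda>t. - ?D (x - t *\<^sub>R z)"] g' by blast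
      have width: "real (Suc j) / real N - real j / real N = 1 / real N"
        by (simp add: diff_divide_distrib[symmetric])
      have le1: "real (Suc j) / real N \<le> 1" using j N(1) by (simp add: divide_le_eq_1)
      have mem: "x - t *\<^sub>R z \<in> cball 0 (r + norm z)" if "0 \<le> t" "t \<le> 1" for t
      proof -
        have "norm (x - t *\<^sub>R z) \<le> norm x + norm (t *\<^sub>R z)" by (rule norm_triangle_ineq4)
        also have "norm (t *\<^sub>R z) \<le> norm z" using that by (simp add: mult_left_le_one_le)
        finally show ?thesis using r[OF x] by simp
      qed
      have pos: "0 \<le> real j / real N" by simp
      have "dist (x - (real j / real N) *\<^sub>R z) (x - \<xi> *\<^sub>R z) = norm ((\<xi> - real j / real N) *\<^sub>R z)"
        by (simp add: dist_norm algebra_simps)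
      also have "\<dots> = (\<xi> - real j / real N) * norm z" using \<xi>(1) by simp
      also have "\<dots> \<le> (1 / real N) * norm z"
        using \<xi>(2) width by (intro mult_right_mono) auto
      also have "\<dots> < d" using N(2) by simp
      finally have "\<bar>?D (x - (real j / real N) *\<^sub>R z) - ?D (x - \<xi> *\<^sub>R z)\<bar> < e"
        using d(2)[of "x - \<xi> *\<^sub>R z" "x - (real j / real N) *\<^sub>R z"] mem[of \<xi>] mem[of "real j / real N"] \<xi> le1 pos
        by (simp add: dist_real_def)
      moreover have "g (real j / real N) - g (real (Suc j) / real N) = ?D (x - \<xi> *\<^sub>R z) / real N"
        using \<xi>(3) unfolding width by simp
      ultimately show ?thesis
        using N(1) by (simp add: diff_divide_distrib[symmetric] abs_divide divide_right_mono)
    qed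
    have "(\<Sum>j<N. g (real j / real N) - g (real (Suc j) / real N)) = \<psi> x - \<psi> (x - z)"
      using N(1) by (subst sum_lessThan_telescope') (simp add: g_def)
    then have "\<bar>(\<Sum>j<N. ?D (x - (real j / real N) *\<^sub>R z)) / real N - (\<psi> x - \<psi> (x - z))\<bar> =
       \<bar>\<Sum>j<N. ?D (x - (real j / real N) *\<^sub>R z) / real N - (g (real j / real N) - g (real (Suc j) / real N))\<bar>"
      by (simp add: sum_divide_distrib sum_subtractf)
    also have "\<dots> \<le> (\<Sum>j<N. e / real N)"
      by (intro order_trans[OF sum_abs] sum_mono step) auto
    also have "\<dots> = e" using N(1) by simp
    finally have "\<bar>a\<bar> * \<bar>(\<Sum>j<N. ?D (x - (real j / real N) *\<^sub>R z)) / real N - (\<psi> x - \<psi> (x - z))\<bar> \<le> \<bar>a\<bar> * e"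
      by (intro mult_left_mono) auto
    then show ?thesis
      by (simp add: divergence_riemann_field[OF \<psi>] right_diff_distrib flip: abs_mult)
  qed
  then show ?thesis using N(1) by blast
qed

lemma riemann_field_test_field:
  fixes \<psi> :: "real^'n \<Rightarrow> real"
  assumes \<psi>: "smooth_on UNIV \<psi>" and T: "compact T" "(\<Union>x\<in>T. cball x (norm z)) \<subseteq> U" "\<And>x. x \<notin> T \<Longrightarrow> \<psi> x = 0"
  shows "riemann_field N a z \<psi> \<in> test_fields U"
proof -
  let ?T = "\<Union>x\<in>T. cball x (norm z)"
  have "x \<in> ?T" if nz: "riemann_field N a z \<psi> x \<noteq> 0" for x
  proof -
    have "\<exists>j<N. \<psi> (x - (real j / real N) *\<^sub>R z) \<noteq> 0"
    proof (rule ccontr)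
      assume "\<not> ?thesis"
      then have "(\<Sum>j<N. \<psi> (x - (real j / real N) *\<^sub>R z)) = 0"
        by (intro sum.neutral) auto
      then show False using nz by (simp add: riemann_field_def)
    qed
    then obtain j where j: "j < N" "\<psi> (x - (real j / real N) *\<^sub>R z) \<noteq> 0" by blast
    have "norm ((real j / real N) *\<^sub>R z) \<le> norm z"
      using j(1) mult_right_mono[of "real j / real N" 1 "norm z"] by simp
    then have "x \<in> cball (x - (real j / real N) *\<^sub>R z) (norm z)"
      by (simp add: dist_norm)
    then show ?thesis
      using T(3) j(2) by blast
  qed
  moreover have "compact ?T"
    using T(1) by (rule compact_minkowski_sum_cball)
  ultimately have sub: "closure {x. riemann_field N a z \<psi> x \<noteq> 0} \<subseteq> ?T"
    by (intro closure_minimal) (auto intro: compact_imp_closed)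
  with \<open>compact ?T\<close> have "compact (closure {x. riemann_field N a z \<psi> x \<noteq> 0})"
    using compact_Int_closed[of ?T "closure {x. riemann_field N a z \<psi> x \<noteq> 0}"]
    by (simp add: Int_absorb1)
  then show ?thesis
    using sub T(2) smooth_riemann_field[OF \<psi>] by (auto simp: test_fields_def)
qed

lemma norm_riemann_field_le:
  assumes "\<And>x. \<bar>\<psi> x\<bar> \<le> s"
  shows "norm (riemann_field N a z \<psi> x) \<le> \<bar>a\<bar> * s * norm z"
proof (cases "N = 0")
  case True
  have "0 \<le> s" using assms[of 0] by linarith
  then show ?thesis using True by (simp add: riemann_field_def)
next
  case False
  have "\<bar>\<Sum>j<N. \<psi> (x - (real j / real N) *\<^sub>R z)\<bar> \<le> (\<Sum>j<N. s)"
    by (intro order_trans[OF sum_abs] sum_mono assms)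
  then have "\<bar>\<Sum>j<N. \<psi> (x - (real j / real N) *\<^sub>R z)\<bar> * (\<bar>a\<bar> / real N * norm z) \<le> real N * s * (\<bar>a\<bar> / real N * norm z)"
    by (intro mult_right_mono) auto
  then show ?thesis
    using False by (simp add: riemann_field_def abs_mult mult_ac)
qed

lemma integrable_mult_continuous:
  fixes \<gamma> h :: "real^'n \<Rightarrow> real"
  assumes "integrable (lebesgue_on U) \<gamma>" "bounded U" "U \<in> sets lebesgue" "continuous_on UNIV h"
  shows "integrable (lebesgue_on U) (\<lambda>x. \<gamma> x * h x)"
proof -
  have "bounded (h ` closure U)"
    using assms by (intro compact_imp_bounded compact_continuous_image)
      (auto intro: continuous_on_subset simp: compact_closure)
  then obtain B where B: "\<And>x. x \<in> U \<Longrightarrow> \<bar>h x\<bar> \<le> B"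
    using closure_subset by (force simp: bounded_iff)
  have h: "h \<in> borel_measurable (lebesgue_on U)"
    by (intro continuous_imp_measurable_on_sets_lebesgue assms(3) continuous_on_subset[OF assms(4)]) auto
  show ?thesis
  proof (rule Bochner_Integration.integrable_bound[of _ "\<lambda>x. B * \<gamma> x"])
    show "integrable (lebesgue_on U) (\<lambda>x. B * \<gamma> x)" using assms(1) by simp
    show "(\<lambda>x. \<gamma> x * h x) \<in> borel_measurable (lebesgue_on U)"
      using h assms(1) by measurable
    have "\<bar>\<gamma> x * h x\<bar> \<le> \<bar>B * \<gamma> x\<bar>" if "x \<in> U" for x
      using B[OF that] by (simp add: abs_mult mult.commute[of "\<bar>\<gamma> x\<bar>"] mult_right_mono)
    then show "AE x in lebesgue_on U. norm (\<gamma> x * h x) \<le> norm (B * \<gamma> x)"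
      by (intro AE_I2) auto
  qed
qed

text \<open>The variation bound, tested on Riemann fields of direction \<open>z\<close> that are normalised by
  \<open>a = 1 / (s \<bar>z\<bar>)\<close>, controls the pairing of \<open>\<gamma>\<close> with a difference of translates of \<open>\<psi>\<close>.\<close>

lemma variation_imp_difference_le:
  fixes \<psi> \<gamma> :: "real^'n \<Rightarrow> real"
  assumes \<gamma>: "integrable (lebesgue_on U) \<gamma>" "variation U \<gamma> \<le> ereal R" and U: "bounded U" "U \<in> sets lebesgue"
    and \<psi>: "smooth_on UNIV \<psi>" "\<And>x. \<bar>\<psi> x\<bar> \<le> s"
    and T: "compact T" "(\<Union>x\<in>T. cball x (norm z)) \<subseteq> U" "\<And>x. x \<notin> T \<Longrightarrow> \<psi> x = 0"
  shows "(\<integral>x. \<gamma> x * (\<psi> x - \<psi> (x - z)) \<partial>lebesgue_on U) \<le> R * (s * norm z)"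
proof (cases "s * norm z = 0")
  case True
  have "s = 0 \<Longrightarrow> \<psi> x = 0" for x using \<psi>(2)[of x] by simp
  then have "\<psi> x - \<psi> (x - z) = 0" for x using True by auto
  then show ?thesis unfolding True by simp
next
  case False
  have "0 \<le> s" using \<psi>(2)[of 0] by linarith
  then have "0 \<le> s * norm z" by simp
  with False have pos: "0 < s * norm z" by linarith
  define a where "a = 1 / (s * norm z)"
  have a: "0 < a" "a * (s * norm z) = 1" using pos by (auto simp: a_def)
  let ?I = "\<integral>x. \<gamma> x * (\<psi> x - \<psi> (x - z)) \<partial>lebesgue_on U"
  let ?G = "\<integral>x. \<bar>\<gamma> x\<bar> \<partial>lebesgue_on U"
  have c\<psi>: "continuous_on UNIV \<psi>"
    using \<psi>(1) by (rule smooth_on_UNIV_continuous)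
  then have c: "continuous_on UNIV (\<lambda>x. \<psi> x - \<psi> (x - z))"
    by (intro continuous_intros) (auto intro!: continuous_on_compose2[OF c\<psi>] continuous_intros)
  have *: "a * ?I \<le> R + a * e * ?G" if e: "0 < e" for e
  proof -
    obtain N where N: "\<And>x. x \<in> U \<Longrightarrow> \<bar>divergence (riemann_field N a z \<psi>) x - a * (\<psi> x - \<psi> (x - z))\<bar> \<le> a * e"
      using divergence_riemann_field_approx[OF \<psi>(1) U(1) e, of a z] a(1) by auto
    let ?\<phi> = "riemann_field N a z \<psi>"
    have "norm (?\<phi> x) \<le> 1" for x
      using norm_riemann_field_le[of \<psi> s N a z x, OF \<psi>(2)] a by (simp add: mult.assoc)
    then have "?\<phi> \<in> {\<phi> \<in> test_fields U. AE x in lebesgue_on U. norm (\<phi> x) \<le> 1}"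
      using riemann_field_test_field[OF \<psi>(1) T] by simp
    then have "ereal (\<integral>x. \<gamma> x * divergence ?\<phi> x \<partial>lebesgue_on U) \<le> variation U \<gamma>"
      unfolding variation_def by (rule SUP_upper)
    with \<gamma>(2) have div: "(\<integral>x. \<gamma> x * divergence ?\<phi> x \<partial>lebesgue_on U) \<le> R"
      using order_trans by fastforce
    have i1: "integrable (lebesgue_on U) (\<lambda>x. \<gamma> x * divergence ?\<phi> x)"
      by (intro integrable_mult_continuous \<gamma>(1) U continuous_on_divergence_riemann_field \<psi>(1))
    have i2: "integrable (lebesgue_on U) (\<lambda>x. \<gamma> x * (\<psi> x - \<psi> (x - z)))"
      by (intro integrable_mult_continuous \<gamma>(1) U c)
    have "a * ?I = (\<integral>x. a * (\<gamma> x * (\<psi> x - \<psi> (x - z))) \<partial>lebesgue_on U)"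
      by simp
    also have "\<dots> \<le> (\<integral>x. \<gamma> x * divergence ?\<phi> x + a * e * \<bar>\<gamma> x\<bar> \<partial>lebesgue_on U)"
    proof (rule integral_mono)
      fix x assume "x \<in> space (lebesgue_on U)"
      then have "\<bar>a * (\<psi> x - \<psi> (x - z)) - divergence ?\<phi> x\<bar> \<le> a * e"
        using N by (simp add: abs_minus_commute)
      then have "\<bar>\<gamma> x\<bar> * \<bar>a * (\<psi> x - \<psi> (x - z)) - divergence ?\<phi> x\<bar> \<le> \<bar>\<gamma> x\<bar> * (a * e)"
        by (intro mult_left_mono) auto
      then have "\<gamma> x * (a * (\<psi> x - \<psi> (x - z)) - divergence ?\<phi> x) \<le> \<bar>\<gamma> x\<bar> * (a * e)"
        unfolding abs_mult[symmetric] by linarith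
      then show "a * (\<gamma> x * (\<psi> x - \<psi> (x - z))) \<le> \<gamma> x * divergence ?\<phi> x + a * e * \<bar>\<gamma> x\<bar>"
        by (simp add: algebra_simps)
    qed (use i1 i2 \<gamma>(1) in auto)
    also have "\<dots> = (\<integral>x. \<gamma> x * divergence ?\<phi> x \<partial>lebesgue_on U) + a * e * ?G"
      using i1 \<gamma>(1) by simp
    finally show ?thesis using div by linarith
  qed
  have "a * ?I \<le> R"
  proof (rule field_le_epsilon)
    fix \<epsilon> :: real assume \<epsilon>: "0 < \<epsilon>"
    have "0 \<le> ?G" by simp
    then have G: "0 < ?G + 1" by linarith
    define e where "e = \<epsilon> / (a * (?G + 1))"
    have "0 < e" unfolding e_def by (intro divide_pos_pos mult_pos_pos \<epsilon> a(1) G)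
    have "a * e * (?G + 1) = \<epsilon>"
      using a(1) G by (simp add: e_def)
    then have "a * e * ?G \<le> \<epsilon>"
      using mult_pos_pos[OF a(1) \<open>0 < e\<close>] unfolding distrib_left by linarith
    with *[OF \<open>0 < e\<close>] show "a * ?I \<le> R + \<epsilon>" by linarith
  qed
  then have "(s * norm z) * (a * ?I) \<le> (s * norm z) * R"
    using pos by (intro mult_left_mono) auto
  moreover have "(s * norm z) * (a * ?I) = (a * (s * norm z)) * ?I"
    by (simp only: mult_ac)
  ultimately have "?I \<le> (s * norm z) * R"
    unfolding a(2) by simp
  then show ?thesis by (simp add: mult.commute)
qed

section \<open>Bounded variation and translations in the mean\<close>

lemma integral_lborel_translate:
  fixes f :: "'a::euclidean_space \<Rightarrow> real"
  assumes [measurable]: "f \<in> borel_measurable borel"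
  shows "(\<integral>x. f (z + x) \<partial>lborel) = (\<integral>x. f x \<partial>lborel)"
    and "integrable lborel (\<lambda>x. f (z + x)) \<longleftrightarrow> integrable lborel f"
proof -
  have "(\<integral>x. f x \<partial>lborel) = (\<integral>x. f x \<partial>distr lborel borel ((+) z))"
    by (simp add: lborel_distr_plus)
  also have "\<dots> = (\<integral>x. f (z + x) \<partial>lborel)"
    by (rule integral_distr) auto
  finally show "(\<integral>x. f (z + x) \<partial>lborel) = (\<integral>x. f x \<partial>lborel)" ..
  have "integrable lborel f \<longleftrightarrow> integrable (distr lborel borel ((+) z)) f"
    by (simp add: lborel_distr_plus)
  also have "\<dots> \<longleftrightarrow> integrable lborel (\<lambda>x. f (z + x))"
    by (rule integrable_distr_eq) auto
  finally show "integrable lborel (\<lambda>x. f (z + x)) \<longleftrightarrow> integrable lborel f" ..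
qed

lemma integrable_lborel_bounded_compact_support:
  fixes f :: "'a::euclidean_space \<Rightarrow> real"
  assumes "f \<in> borel_measurable borel" "\<And>x. \<bar>f x\<bar> \<le> C" "compact T" "\<And>x. x \<notin> T \<Longrightarrow> f x = 0"
  shows "integrable lborel f"
proof (rule Bochner_Integration.integrable_bound[of _ "\<lambda>x. C * indicator T x"])
  have "emeasure lborel T < \<infinity>"
    using assms(3) by (rule emeasure_compact_finite)
  moreover have "T \<in> sets lborel" using assms(3) by (simp add: borel_compact)
  ultimately show "integrable lborel (\<lambda>x. C * indicator T x)"
    by (intro integrable_mult_right integrable_real_indicator)
  show "AE x in lborel. norm (f x) \<le> norm (C * indicator T x)"
    using assms(2,4) by (intro AE_I2) (auto simp: indicator_def intro: order_trans[OF _ abs_ge_self])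
qed (use assms(1) in simp)

lemma continuous_compact_support_bounded:
  fixes \<psi> :: "'a::euclidean_space \<Rightarrow> real"
  assumes "continuous_on UNIV \<psi>" "compact T" "\<And>x. x \<notin> T \<Longrightarrow> \<psi> x = 0"
  obtains B where "0 < B" "\<And>x. \<bar>\<psi> x\<bar> \<le> B"
proof -
  have "bounded (\<psi> ` T)"
    by (intro compact_imp_bounded compact_continuous_image assms(2) continuous_on_subset[OF assms(1)]) auto
  then obtain B where B: "0 < B" "\<And>x. x \<in> T \<Longrightarrow> \<bar>\<psi> x\<bar> \<le> B"
    by (auto simp: bounded_pos)
  have "\<bar>\<psi> x\<bar> \<le> B" for x
    using B assms(3)[of x] by (cases "x \<in> T") auto
  then show ?thesis using that B(1) by blast
qed

lemma integral_difference_pairing: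
  fixes w \<psi> :: "'a::euclidean_space \<Rightarrow> real"
  assumes w: "w \<in> borel_measurable borel" "\<And>x. \<bar>w x\<bar> \<le> C"
    and \<psi>: "continuous_on UNIV \<psi>" "compact T" "\<And>x. x \<notin> T \<Longrightarrow> \<psi> x = 0"
  shows "(\<integral>x. (w x - w (z + x)) * \<psi> x \<partial>lborel) = (\<integral>x. w x * (\<psi> x - \<psi> (x - z)) \<partial>lborel)"
    and "integrable lborel (\<lambda>x. w x * (\<psi> x - \<psi> (x - z)))"
    and "integrable lborel (\<lambda>x. \<psi> x - \<psi> (x - z))"
    and "(\<integral>x. \<psi> x - \<psi> (x - z) \<partial>lborel) = 0"
proof -
  note [measurable] = w(1)
  have [measurable]: "\<psi> \<in> borel_measurable borel"
    using \<psi>(1) by (rule borel_measurable_continuous_onI)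
  obtain B where B: "0 < B" "\<And>x. \<bar>\<psi> x\<bar> \<le> B"
    using continuous_compact_support_bounded[OF \<psi>] by metis
  have C: "0 \<le> C" using w(2)[of 0] by linarith
  have i1: "integrable lborel (\<lambda>x. v x * \<psi> x)"
    if "v \<in> borel_measurable borel" "\<And>x. \<bar>v x\<bar> \<le> D" for v D
  proof (rule integrable_lborel_bounded_compact_support[of _ "D * B" T])
    have "0 \<le> D" using that(2)[of 0] by linarith
    then show "\<bar>v x * \<psi> x\<bar> \<le> D * B" for x
      using that(2) B by (simp add: abs_mult mult_mono)
  qed (use \<psi> that(1) in auto)
  have iw: "integrable lborel (\<lambda>x. w x * \<psi> x)" "integrable lborel (\<lambda>x. w (z + x) * \<psi> x)"
    by (rule i1[of _ C]; use w(2) in simp)+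
  have i\<psi>: "integrable lborel \<psi>"
    using i1[of "\<lambda>x. 1" 1] by simp
  have shift: "integrable lborel (\<lambda>x. w x * \<psi> (x - z))"
      "(\<integral>x. w (z + x) * \<psi> x \<partial>lborel) = (\<integral>x. w x * \<psi> (x - z) \<partial>lborel)"
    using integral_lborel_translate[of "\<lambda>x. w x * \<psi> (x - z)" z] iw(2) by simp_all
  have shift\<psi>: "integrable lborel (\<lambda>x. \<psi> (x - z))"
      "(\<integral>x. \<psi> x \<partial>lborel) = (\<integral>x. \<psi> (x - z) \<partial>lborel)"
    using integral_lborel_translate[of "\<lambda>x. \<psi> (x - z)" z] i\<psi> by simp_all
  show "integrable lborel (\<lambda>x. w x * (\<psi> x - \<psi> (x - z)))"
    using iw(1) shift(1) by (simp add: right_diff_distrib)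
  show "(\<integral>x. (w x - w (z + x)) * \<psi> x \<partial>lborel) = (\<integral>x. w x * (\<psi> x - \<psi> (x - z)) \<partial>lborel)"
    using iw shift by (simp add: left_diff_distrib right_diff_distrib)
  show "integrable lborel (\<lambda>x. \<psi> x - \<psi> (x - z))" "(\<integral>x. \<psi> x - \<psi> (x - z) \<partial>lborel) = 0"
    using i\<psi> shift\<psi> by simp_all
qed

lemma integral_lebesgue_on_eq_lborel:
  fixes \<gamma> v h :: "'a::euclidean_space \<Rightarrow> real"
  assumes "U \<in> sets lebesgue" and \<gamma>: "\<gamma> \<in> borel_measurable (lebesgue_on U)"
    and v: "v \<in> borel_measurable borel" and ae: "AE x in lebesgue_on U. \<gamma> x = v x"
    and h: "continuous_on UNIV h" "\<And>x. x \<notin> U \<Longrightarrow> h x = 0"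
  shows "(\<integral>x. \<gamma> x * h x \<partial>lebesgue_on U) = (\<integral>x. v x * h x \<partial>lborel)"
proof -
  have hb: "h \<in> borel_measurable borel"
    using h(1) by (rule borel_measurable_continuous_onI)
  have m: "f \<in> borel_measurable (lebesgue_on U)" if "f \<in> borel_measurable borel" for f :: "'a \<Rightarrow> real"
    using that by (intro measurable_restrict_space1 measurable_completion) simp
  have "(\<integral>x. \<gamma> x * h x \<partial>lebesgue_on U) = (\<integral>x. v x * h x \<partial>lebesgue_on U)"
    using m[OF v] m[OF hb] \<gamma> ae by (intro integral_cong_AE) auto
  also have "\<dots> = (\<integral>x. indicator U x *\<^sub>R (v x * h x) \<partial>lebesgue)"
    using assms(1) by (intro integral_restrict_space) simp
  also have "\<dots> = (\<integral>x. v x * h x \<partial>lebesgue)"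
    using h(2) by (intro Bochner_Integration.integral_cong) (auto simp: indicator_def)
  also have "\<dots> = (\<integral>x. v x * h x \<partial>lborel)"
    using v hb by (intro integral_completion) simp
  finally show ?thesis .
qed

text \<open>Replacing \<open>\<gamma>\<close> by \<open>w = \<gamma> - 1\<close> is harmless, because differences of translates of \<open>\<psi>\<close> have
  integral zero. The shift can then be moved from \<open>\<psi>\<close> to \<open>w\<close>.\<close>

lemma translation_difference_pairing_le:
  fixes w \<gamma> \<psi> :: "real^'n \<Rightarrow> real"
  assumes U: "bounded U" "U \<in> sets lebesgue"
    and \<gamma>: "integrable (lebesgue_on U) \<gamma>" "variation U \<gamma> \<le> ereal R"
    and w: "w \<in> borel_measurable borel" "\<And>x. \<bar>w x\<bar> \<le> C" "AE x in lebesgue_on U. \<gamma> x = 1 + w x"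
    and \<psi>: "smooth_on UNIV \<psi>" "\<And>x. \<bar>\<psi> x\<bar> \<le> s"
    and T: "compact T" "(\<Union>x\<in>T. cball x (norm z)) \<subseteq> U" "\<And>x. x \<notin> T \<Longrightarrow> \<psi> x = 0"
  shows "(\<integral>x. (w x - w (z + x)) * \<psi> x \<partial>lborel) \<le> R * (s * norm z)"
proof -
  have c: "continuous_on UNIV \<psi>"
    using \<psi>(1) by (rule smooth_on_UNIV_continuous)
  have ch: "continuous_on UNIV (\<lambda>x. \<psi> x - \<psi> (x - z))"
    by (intro continuous_on_diff c continuous_on_compose2[OF c] continuous_on_id continuous_on_const) auto
  have zero: "\<psi> x - \<psi> (x - z) = 0" if x: "x \<notin> U" for x
  proof -
    have "x \<notin> T"
    proof
      assume "x \<in> T"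
      then have "x \<in> (\<Union>x\<in>T. cball x (norm z))"
        by (rule UN_I) simp
      then show False using T(2) x by blast
    qed
    moreover have "x - z \<notin> T"
    proof
      assume "x - z \<in> T"
      then have "x \<in> (\<Union>x\<in>T. cball x (norm z))"
        by (rule UN_I) (simp add: dist_norm)
      then show False using T(2) x by blast
    qed
    ultimately show ?thesis using T(3) by simp
  qed
  have p: "(\<integral>x. (w x - w (z + x)) * \<psi> x \<partial>lborel) = (\<integral>x. w x * (\<psi> x - \<psi> (x - z)) \<partial>lborel)"
    "integrable lborel (\<lambda>x. w x * (\<psi> x - \<psi> (x - z)))"
    "integrable lborel (\<lambda>x. \<psi> x - \<psi> (x - z))" "(\<integral>x. \<psi> x - \<psi> (x - z) \<partial>lborel) = 0"
    by (rule integral_difference_pairing[OF w(1,2) c T(1)]; rule T(3); assumption)+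
  have "(\<integral>x. (w x - w (z + x)) * \<psi> x \<partial>lborel) =
      (\<integral>x. \<psi> x - \<psi> (x - z) \<partial>lborel) + (\<integral>x. w x * (\<psi> x - \<psi> (x - z)) \<partial>lborel)"
    by (subst p(4), subst p(1)) (rule add_0_left[symmetric])
  also have "\<dots> = (\<integral>x. (\<psi> x - \<psi> (x - z)) + w x * (\<psi> x - \<psi> (x - z)) \<partial>lborel)"
    by (rule Bochner_Integration.integral_add[OF p(3) p(2), symmetric])
  also have "\<dots> = (\<integral>x. (1 + w x) * (\<psi> x - \<psi> (x - z)) \<partial>lborel)"
    by (intro Bochner_Integration.integral_cong) (auto simp: distrib_right)
  also have "\<dots> = (\<integral>x. \<gamma> x * (\<psi> x - \<psi> (x - z)) \<partial>lebesgue_on U)"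
    using integral_lebesgue_on_eq_lborel[OF U(2) _ _ w(3) ch zero] \<gamma>(1) w(1) by simp
  also have "\<dots> \<le> R * (s * norm z)"
    by (rule variation_imp_difference_le[OF \<gamma> U \<psi> T])
  finally show ?thesis .
qed

text \<open>The \<open>L\<^sup>1\<close> norm of the difference of \<open>w\<close> and its translate is the supremum of its pairings
  with smooth functions bounded by \<open>1\<close>, since these approximate its sign.\<close>

lemma variation_imp_translation_L1_le:
  fixes w \<gamma> :: "real^'n \<Rightarrow> real"
  assumes U: "bounded U" "U \<in> sets lebesgue" and R: "0 \<le> R"
    and \<gamma>: "integrable (lebesgue_on U) \<gamma>" "variation U \<gamma> \<le> ereal R"
    and w: "w \<in> borel_measurable borel" "\<And>x. \<bar>w x\<bar> \<le> C" "AE x in lebesgue_on U. \<gamma> x = 1 + w x"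
    and K: "compact K" "\<And>x. x \<notin> K \<Longrightarrow> w x = 0"
    and h: "0 < h" "(\<Union>x\<in>K. cball x (4 * h)) \<subseteq> U" "norm z \<le> h"
  shows "(\<integral>x. \<bar>w x - w (z + x)\<bar> \<partial>lborel) \<le> R * norm z"
proof -
  note [measurable] = w(1)
  define f where "f x = w x - w (z + x)" for x
  have [measurable]: "f \<in> borel_measurable borel" unfolding f_def by measurable
  \<comment> \<open>The difference \<open>f\<close> lives on \<open>K1\<close>, the continuous approximants of its sign on \<open>K2\<close>, the smooth
    ones on \<open>O2\<close>; shifting the latter by \<open>z\<close> stays within distance \<open>4 * h\<close> of \<open>K\<close>, hence in \<open>U\<close>.\<close>
  define K1 where "K1 = (\<Union>x\<in>K. cball x h)"
  define K2 where "K2 = (\<Union>x\<in>K. cball x (2 * h))"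
  define O1 where "O1 = (\<Union>x\<in>K. ball x (2 * h))"
  define O2 where "O2 = (\<Union>x\<in>K. ball x (3 * h))"
  have K1: "compact K1" "compact K2" "open O1" "open O2"
    using K(1) by (auto simp: K1_def K2_def O1_def O2_def intro: compact_minkowski_sum_cball)
  have sub: "K1 \<subseteq> O1" "O1 \<subseteq> K2" "K2 \<subseteq> O2"
    unfolding K1_def O1_def K2_def O2_def by (intro UN_mono; use h(1) in auto)+
  have f_zero: "f x = 0" if "x \<notin> K1" for x
  proof -
    have "x \<notin> K" using that h(1) unfolding K1_def by (metis UN_I centre_in_cball order_less_imp_le)
    moreover have "z + x \<notin> K"
    proof
      assume "z + x \<in> K"
      then have "x \<in> K1" unfolding K1_def by (rule UN_I) (use h(3) in \<open>simp add: dist_norm\<close>)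
      then show False using that by blast
    qed
    ultimately show ?thesis using K(2) by (simp add: f_def)
  qed
  have f_bound: "\<bar>f x\<bar> \<le> 2 * C" for x
    using w(2)[of x] w(2)[of "z + x"] by (simp add: f_def)
  have f_int: "integrable lborel f"
    by (rule integrable_lborel_bounded_compact_support[OF _ f_bound K1(1) f_zero]) auto
  obtain \<eta> :: "real^'n \<Rightarrow> real" where \<eta>: "continuous_on UNIV \<eta>" "\<And>x. \<eta> x \<in> closed_segment 1 0"
      "\<And>x. x \<in> K1 \<Longrightarrow> \<eta> x = 1" "\<And>x. x \<in> - O1 \<Longrightarrow> \<eta> x = 0"
    by (rule Urysohn[of K1 "- O1" 1 "0::real"]) (use K1 sub in \<open>auto intro: compact_imp_closed\<close>)
  have \<eta>01: "0 \<le> \<eta> x" "\<eta> x \<le> 1" for x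
    using \<eta>(2)[of x] by (auto simp: closed_segment_eq_real_ivl)
  have pairing: "(\<integral>x. f x * g x \<partial>lborel) \<le> R * norm z"
    if g: "continuous_on UNIV g" "\<And>x. \<bar>g x\<bar> \<le> 1" "\<And>x. x \<notin> K2 \<Longrightarrow> g x = 0" for g
  proof (rule field_le_epsilon)
    fix \<epsilon> :: real assume \<epsilon>: "0 < \<epsilon>"
    define I where "I = (\<integral>x. \<bar>f x\<bar> \<partial>lborel)"
    have I: "0 \<le> I" by (simp add: I_def)
    define e where "e = \<epsilon> / (R * norm z + I + 1)"
    have den: "0 < R * norm z + I + 1"
      using I mult_nonneg_nonneg[OF R norm_ge_zero[of z]] by linarith
    have e: "0 < e" using \<epsilon> den by (simp add: e_def)
    have "e * (R * norm z + I + 1) = \<epsilon>"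
      using den by (simp add: e_def)
    then have e_le: "e * (R * norm z) + e * I \<le> \<epsilon>"
      using e by (simp add: distrib_left)
    obtain \<psi> T where \<psi>: "smooth_on UNIV \<psi>" and T: "compact T" "T \<subseteq> O2" "\<And>x. x \<notin> T \<Longrightarrow> \<psi> x = 0"
      and close: "\<And>x. \<bar>\<psi> x - g x\<bar> \<le> e"
      using smooth_approximation_compact_support[OF K1(2) K1(4) sub(3) g(1) g(3) e] by metis
    have \<psi>_bound: "\<bar>\<psi> x\<bar> \<le> 1 + e" for x
      using close[of x] g(2)[of x] by linarith
    have "(\<Union>x\<in>T. cball x (norm z)) \<subseteq> U"
    proof
      fix y assume "y \<in> (\<Union>x\<in>T. cball x (norm z))"
      then obtain x where x: "x \<in> T" "dist x y \<le> norm z" by auto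
      then obtain k where k: "k \<in> K" "dist k x < 3 * h" using T(2) by (auto simp: O2_def)
      have "dist k y \<le> 4 * h"
        using dist_triangle[of k y x] x(2) k(2) h(3) by linarith
      then have "y \<in> (\<Union>x\<in>K. cball x (4 * h))"
        by (intro UN_I[OF k(1)]) simp
      then show "y \<in> U" using h(2) by blast
    qed
    from translation_difference_pairing_le[OF U \<gamma> w \<psi> \<psi>_bound T(1) this T(3)]
    have le: "(\<integral>x. f x * \<psi> x \<partial>lborel) \<le> R * ((1 + e) * norm z)"
      by (simp add: f_def)
    have [measurable]: "g \<in> borel_measurable borel" "\<psi> \<in> borel_measurable borel"
      using g(1) smooth_on_UNIV_continuous[OF \<psi>] by (auto intro: borel_measurable_continuous_onI)
    have fp: "integrable lborel (\<lambda>x. f x * u x)"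
      if "u \<in> borel_measurable borel" "\<And>x. \<bar>u x\<bar> \<le> D" for u D
    proof (rule integrable_lborel_bounded_compact_support[OF _ _ K1(1)])
      show "\<bar>f x * u x\<bar> \<le> (2 * C) * D" for x
        unfolding abs_mult using f_bound that(2) order_trans[OF abs_ge_zero f_bound]
        by (intro mult_mono) auto
    qed (use f_zero that(1) in auto)
    have "(\<integral>x. f x * g x \<partial>lborel) \<le> (\<integral>x. f x * \<psi> x + e * \<bar>f x\<bar> \<partial>lborel)"
    proof (rule integral_mono)
      fix x
      have "\<bar>f x\<bar> * \<bar>g x - \<psi> x\<bar> \<le> \<bar>f x\<bar> * e"
        using close[of x] by (intro mult_left_mono) (auto simp: abs_minus_commute)
      then have "f x * (g x - \<psi> x) \<le> \<bar>f x\<bar> * e"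
        unfolding abs_mult[symmetric] by linarith
      then show "f x * g x \<le> f x * \<psi> x + e * \<bar>f x\<bar>" by (simp add: algebra_simps)
    qed (use fp[of g 1] fp[of \<psi> "1 + e"] g(2) \<psi>_bound f_int in auto)
    also have "\<dots> = (\<integral>x. f x * \<psi> x \<partial>lborel) + e * I"
      using fp[of \<psi> "1 + e"] \<psi>_bound f_int by (simp add: I_def)
    also have "\<dots> \<le> R * norm z + \<epsilon>"
      using le e_le by (simp add: algebra_simps)
    finally show "(\<integral>x. f x * g x \<partial>lborel) \<le> R * norm z + \<epsilon>" .
  qed
  have "(\<lambda>x. sgn (f x)) \<in> borel_measurable lebesgue"
    by (intro measurable_completion) measurable
  then have "(\<lambda>x. sgn (f x)) measurable_on UNIV"
    by (intro lebesgue_measurable_imp_measurable_on) auto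
  then obtain N G where N: "negligible N" and G: "\<And>n. continuous_on UNIV (G n)"
      "\<And>x. x \<notin> N \<Longrightarrow> (\<lambda>n. G n x) \<longlonglongrightarrow> sgn (f x)"
    unfolding measurable_on_def by auto
  define g where "g n x = \<eta> x * max (- 1) (min 1 (G n x))" for n x
  have g: "continuous_on UNIV (g n)" "\<bar>g n x\<bar> \<le> 1" "x \<notin> K2 \<Longrightarrow> g n x = 0" for n x
  proof -
    show "continuous_on UNIV (g n)"
      unfolding g_def by (intro continuous_on_mult \<eta>(1) continuous_on_max continuous_on_min G continuous_on_const)
    show "\<bar>g n x\<bar> \<le> 1"
      unfolding g_def abs_mult using \<eta>01[of x] by (intro mult_le_one) auto
    show "g n x = 0" if "x \<notin> K2"
      using that sub \<eta>(4)[of x] by (auto simp: g_def)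
  qed
  have lim: "(\<lambda>n. f x * g n x) \<longlonglongrightarrow> \<bar>f x\<bar>" if "x \<notin> N" for x
  proof (cases "x \<in> K1")
    case True
    have "(\<lambda>n. f x * (\<eta> x * max (- 1) (min 1 (G n x)))) \<longlonglongrightarrow> f x * (\<eta> x * max (- 1) (min 1 (sgn (f x))))"
      by (intro tendsto_intros G(2) that)
    moreover have "f x * (\<eta> x * max (- 1) (min 1 (sgn (f x)))) = \<bar>f x\<bar>"
      using \<eta>(3)[OF True] by (auto simp: sgn_if)
    ultimately show ?thesis by (simp add: g_def)
  qed (use f_zero in auto)
  have "(\<lambda>n. \<integral>x. f x * g n x \<partial>lborel) \<longlonglongrightarrow> (\<integral>x. \<bar>f x\<bar> \<partial>lborel)"
  proof (rule integral_dominated_convergence[where w = "\<lambda>x. \<bar>f x\<bar>"])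
    have [measurable]: "g n \<in> borel_measurable borel" for n
      using g(1) by (rule borel_measurable_continuous_onI)
    show "(\<lambda>x. f x * g n x) \<in> borel_measurable lborel" for n by measurable
    have "AE x in lebesgue. x \<notin> N"
      using N by (intro AE_not_in) (simp add: negligible_iff_null_sets)
    then have "AE x in lebesgue. (\<lambda>n. f x * g n x) \<longlonglongrightarrow> \<bar>f x\<bar>"
      using lim by (auto elim: eventually_mono)
    then show "AE x in lborel. (\<lambda>n. f x * g n x) \<longlonglongrightarrow> \<bar>f x\<bar>"
      by (simp only: AE_completion_iff)
    show "AE x in lborel. norm (f x * g n x) \<le> \<bar>f x\<bar>" for n
      using g(2) by (intro AE_I2) (simp add: abs_mult mult_left_le)
  qed (use f_int in auto)
  then have "(\<integral>x. \<bar>f x\<bar> \<partial>lborel) \<le> R * norm z"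
    by (rule LIMSEQ_le_const2) (use pairing g in auto)
  then show ?thesis by (simp add: f_def)
qed

section \<open>Compactness from uniformly continuous translations\<close>

text \<open>A Lipschitz kernel supported in the ball of radius \<open>h\<close>, not normalised.\<close>

definition tent :: "real \<Rightarrow> 'a::euclidean_space \<Rightarrow> real" where
  "tent h z = max 0 (h - norm z)"

lemma tent_nonneg: "0 \<le> tent h z"
  by (simp add: tent_def)

lemma tent_Lipschitz: "\<bar>tent h y - tent h z\<bar> \<le> norm (y - z)"
  unfolding tent_def using norm_triangle_ineq2[of y z] norm_triangle_ineq2[of z y]
  by (auto simp: max_def norm_minus_commute)

lemma continuous_on_tent: "continuous_on UNIV (tent h)"
  unfolding tent_def[abs_def] by (intro continuous_intros)

lemma borel_measurable_tent [measurable]: "tent h \<in> borel_measurable borel"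
  by (rule borel_measurable_continuous_onI[OF continuous_on_tent])

lemma integrable_tent: "integrable lborel (tent h :: 'a::euclidean_space \<Rightarrow> real)"
  by (rule integrable_lborel_bounded_compact_support[of _ "max 0 h" "cball 0 h"])
     (auto simp: tent_def max_def dest: order_trans[OF norm_ge_zero])

lemma integral_tent_pos:
  assumes "0 < h"
  shows "0 < (\<integral>z. tent h z \<partial>(lborel :: 'a::euclidean_space measure))"
proof -
  have "(\<integral>z. tent h z \<partial>(lborel :: 'a measure)) \<noteq> 0"
  proof
    assume "(\<integral>z. tent h z \<partial>(lborel :: 'a measure)) = 0"
    then have "AE z in (lborel :: 'a measure). tent h z = 0"
      by (subst (asm) integral_nonneg_eq_0_iff_AE) (auto intro: integrable_tent simp: tent_nonneg)
    then have "AE z in (lborel :: 'a measure). z \<notin> ball 0 h"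
      by (rule eventually_mono) (auto simp: tent_def max_def split: if_splits)
    then have "emeasure lborel (ball 0 h :: 'a set) = 0"
      by (subst (asm) AE_iff_null_sets[symmetric]) auto
    then show False
      using content_ball_pos[OF assms, of "0::'a"] by (simp add: measure_def)
  qed
  moreover have "0 \<le> (\<integral>z. tent h z \<partial>(lborel :: 'a measure))"
    by (simp add: tent_nonneg)
  ultimately show ?thesis by linarith
qed

text \<open>The weighted mean of \<open>w\<close> over the ball of radius \<open>h\<close> around \<open>x\<close>. The Lipschitz weight makes
  it a Lipschitz function of \<open>x\<close> for bounded \<open>w\<close> of compact support.\<close>

definition tent_mean :: "real \<Rightarrow> ('a::euclidean_space \<Rightarrow> real) \<Rightarrow> 'a \<Rightarrow> real" where
  "tent_mean h w x = (\<integral>z. tent h z * w (z + x) \<partial>lborel) / (\<integral>z. tent h z \<partial>(lborel :: 'a measure))"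

lemma integrable_tent_mult:
  fixes v :: "'a::euclidean_space \<Rightarrow> real"
  assumes [measurable]: "v \<in> borel_measurable borel" and "\<And>x. \<bar>v x\<bar> \<le> C"
  shows "integrable lborel (\<lambda>z. tent h z * v z)"
proof (rule Bochner_Integration.integrable_bound[of _ "\<lambda>z. C * tent h z"])
  show "integrable lborel (\<lambda>z::'a. C * tent h z)" by (intro integrable_mult_right integrable_tent)
  have "\<bar>tent h z * v z\<bar> \<le> \<bar>C * tent h z\<bar>" for z
    using assms(2)[of z] tent_nonneg[of h z]
    by (simp add: abs_mult mult.commute[of "tent h z"] mult_right_mono)
  then show "AE z in lborel. norm (tent h z * v z) \<le> norm (C * tent h z)" by simp
qed measurable

lemma abs_tent_mean_le:
  fixes w :: "'a::euclidean_space \<Rightarrow> real"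
  assumes h: "0 < h" and [measurable]: "w \<in> borel_measurable borel" and "\<And>x. \<bar>w x\<bar> \<le> C"
  shows "\<bar>tent_mean h w x\<bar> \<le> C"
proof -
  let ?c = "\<integral>z. tent h z \<partial>(lborel :: 'a measure)"
  have "\<bar>\<integral>z. tent h z * w (z + x) \<partial>lborel\<bar> \<le> (\<integral>z. \<bar>tent h z * w (z + x)\<bar> \<partial>lborel)"
    by (rule integral_abs_bound)
  also have "\<dots> \<le> (\<integral>z. C * tent h z \<partial>(lborel :: 'a measure))"
  proof (rule integral_mono)
    show "integrable lborel (\<lambda>z. \<bar>tent h z * w (z + x)\<bar>)"
      by (intro integrable_abs integrable_tent_mult[where C = C]) (use assms in auto)
    show "integrable lborel (\<lambda>z::'a. C * tent h z)" by (intro integrable_mult_right integrable_tent)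
    show "\<bar>tent h z * w (z + x)\<bar> \<le> C * tent h z" for z
      using assms(3)[of "z + x"] tent_nonneg[of h z]
      by (simp add: abs_mult mult.commute[of "tent h z"] mult_right_mono)
  qed
  also have "\<dots> = C * ?c" by simp
  finally show ?thesis
    using integral_tent_pos[OF h, where 'a = 'a]
    by (simp add: tent_mean_def abs_divide pos_divide_le_eq)
qed

lemma tent_mean_Lipschitz:
  fixes w :: "'a::euclidean_space \<Rightarrow> real"
  assumes h: "0 < h" and w [measurable]: "w \<in> borel_measurable borel" and C: "\<And>x. \<bar>w x\<bar> \<le> C"
    and K: "compact K" "\<And>x. x \<notin> K \<Longrightarrow> w x = 0"
  shows "\<bar>tent_mean h w x - tent_mean h w y\<bar> \<le>
    C * measure lborel K / (\<integral>z. tent h z \<partial>(lborel :: 'a measure)) * norm (x - y)"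
proof -
  let ?c = "\<integral>z. tent h z \<partial>(lborel :: 'a measure)"
  have shift: "(\<integral>z. tent h z * w (z + x) \<partial>lborel) = (\<integral>z. tent h (z - x) * w z \<partial>lborel)"
      "integrable lborel (\<lambda>z. tent h (z - x) * w z)" for x
  proof -
    have i: "integrable lborel (\<lambda>z. tent h z * w (z + x))"
      by (intro integrable_tent_mult[where C = C]) (use C in auto)
    have m: "(\<lambda>z. tent h (z - x) * w z) \<in> borel_measurable borel" by measurable
    show "(\<integral>z. tent h z * w (z + x) \<partial>lborel) = (\<integral>z. tent h (z - x) * w z \<partial>lborel)"
      using integral_lborel_translate(1)[OF m, of x] by (simp add: add.commute)
    show "integrable lborel (\<lambda>z. tent h (z - x) * w z)"
      using integral_lborel_translate(2)[OF m, of x] i by (simp add: add.commute)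
  qed
  have "\<bar>(\<integral>z. tent h (z - x) * w z \<partial>lborel) - (\<integral>z. tent h (z - y) * w z \<partial>lborel)\<bar>
      = \<bar>\<integral>z. tent h (z - x) * w z - tent h (z - y) * w z \<partial>lborel\<bar>"
    using shift(2) by simp
  also have "\<dots> \<le> (\<integral>z. \<bar>tent h (z - x) * w z - tent h (z - y) * w z\<bar> \<partial>lborel)"
    by (rule integral_abs_bound)
  also have "\<dots> \<le> (\<integral>z. (C * norm (x - y)) * indicator K z \<partial>lborel)"
  proof (rule integral_mono)
    show "integrable lborel (\<lambda>z. \<bar>tent h (z - x) * w z - tent h (z - y) * w z\<bar>)"
      using shift(2) by simp
    show "integrable lborel (\<lambda>z. (C * norm (x - y)) * indicator K z)"
      using K(1) by (intro integrable_mult_right integrable_real_indicator)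
        (use emeasure_compact_finite[OF K(1)] in \<open>simp_all add: borel_compact\<close>)
    show "\<bar>tent h (z - x) * w z - tent h (z - y) * w z\<bar> \<le> (C * norm (x - y)) * indicator K z" for z
    proof (cases "z \<in> K")
      case True
      have "\<bar>tent h (z - x) - tent h (z - y)\<bar> * \<bar>w z\<bar> \<le> norm (x - y) * C"
        using tent_Lipschitz[of h "z - x" "z - y"] C[of z]
        by (intro mult_mono) (auto simp: norm_minus_commute)
      moreover have "\<bar>tent h (z - x) * w z - tent h (z - y) * w z\<bar> = \<bar>tent h (z - x) - tent h (z - y)\<bar> * \<bar>w z\<bar>"
        by (metis abs_mult left_diff_distrib)
      ultimately show ?thesis using True
        by (simp add: mult.commute)
    qed (use K(2) in simp)
  qed
  also have "\<dots> = C * norm (x - y) * measure lborel K"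
    by simp
  finally have "\<bar>(\<integral>z. tent h (z - x) * w z \<partial>lborel) - (\<integral>z. tent h (z - y) * w z \<partial>lborel)\<bar>
      \<le> C * norm (x - y) * measure lborel K" .
  then have "\<bar>(\<integral>z. tent h (z - x) * w z \<partial>lborel) - (\<integral>z. tent h (z - y) * w z \<partial>lborel)\<bar> / ?c
      \<le> C * norm (x - y) * measure lborel K / ?c"
    using integral_tent_pos[OF h, where 'a = 'a] by (intro divide_right_mono) auto
  then show ?thesis
    using integral_tent_pos[OF h, where 'a = 'a]
    by (simp add: tent_mean_def shift(1) diff_divide_distrib[symmetric] abs_divide mult_ac)
qed

text \<open>A mean of translates is as close to \<open>w\<close> in \<open>L\<^sup>1\<close> as the translates are (Tonelli).\<close>

lemma tent_mean_L1_close: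
  fixes w :: "'a::euclidean_space \<Rightarrow> real"
  assumes h: "0 < h" and w [measurable]: "w \<in> borel_measurable borel" and C: "\<And>x. \<bar>w x\<bar> \<le> C"
    and K: "compact K" "\<And>x. x \<notin> K \<Longrightarrow> w x = 0"
    and A: "0 \<le> A" "\<And>z. norm z \<le> h \<Longrightarrow> (\<integral>x. \<bar>w x - w (z + x)\<bar> \<partial>lborel) \<le> A"
  shows "(\<integral>\<^sup>+x. ennreal \<bar>w x - tent_mean h w x\<bar> \<partial>lborel) \<le> ennreal A"
proof -
  let ?c = "\<integral>z. tent h z \<partial>(lborel :: 'a measure)"
  have c: "0 < ?c" using integral_tent_pos[OF h, where 'a = 'a] .
  have w_int: "integrable lborel w"
    by (rule integrable_lborel_bounded_compact_support[OF w C K])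
  have d_int: "integrable lborel (\<lambda>z. tent h z * \<bar>w x - w (z + x)\<bar>)" for x
  proof (rule integrable_tent_mult[where C = "2 * C"])
    show "\<bar>\<bar>w x - w (z + x)\<bar>\<bar> \<le> 2 * C" for z
      using C[of x] C[of "z + x"] by linarith
  qed measurable
  have pw: "\<bar>w x - tent_mean h w x\<bar> \<le> (\<integral>z. tent h z * \<bar>w x - w (z + x)\<bar> \<partial>lborel) / ?c" for x
  proof -
    have i1: "integrable lborel (\<lambda>z. tent h z * w (z + x))"
      by (intro integrable_tent_mult[where C = C]) (use C in auto)
    have i2: "integrable lborel (\<lambda>z::'a. tent h z * w x)"
      by (intro integrable_mult_left integrable_tent)
    have "w x - tent_mean h w x = ((\<integral>z. tent h z * w x \<partial>(lborel :: 'a measure)) - (\<integral>z. tent h z * w (z + x) \<partial>lborel)) / ?c"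
      using c by (simp add: tent_mean_def diff_divide_distrib)
    also have "\<dots> = (\<integral>z. tent h z * (w x - w (z + x)) \<partial>lborel) / ?c"
      using i1 i2 by (simp add: right_diff_distrib)
    finally have "\<bar>w x - tent_mean h w x\<bar> = \<bar>\<integral>z. tent h z * (w x - w (z + x)) \<partial>lborel\<bar> / ?c"
      using c by (simp add: abs_divide)
    also have "\<dots> \<le> (\<integral>z. \<bar>tent h z * (w x - w (z + x))\<bar> \<partial>lborel) / ?c"
      using c by (intro divide_right_mono integral_abs_bound) auto
    finally show ?thesis by (simp add: abs_mult tent_nonneg)
  qed
  have "(\<integral>\<^sup>+x. ennreal \<bar>w x - tent_mean h w x\<bar> \<partial>lborel) \<le>
      (\<integral>\<^sup>+x. (\<integral>\<^sup>+z. ennreal (tent h z / ?c * \<bar>w x - w (z + x)\<bar>) \<partial>lborel) \<partial>lborel)"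
  proof (rule nn_integral_mono)
    fix x
    have "(\<integral>\<^sup>+z. ennreal (tent h z / ?c * \<bar>w x - w (z + x)\<bar>) \<partial>lborel) =
        ennreal (\<integral>z. tent h z / ?c * \<bar>w x - w (z + x)\<bar> \<partial>lborel)"
      using d_int[of x] c by (intro nn_integral_eq_integral) (auto simp: tent_nonneg)
    also have "(\<integral>z. tent h z / ?c * \<bar>w x - w (z + x)\<bar> \<partial>lborel) = (\<integral>z. tent h z * \<bar>w x - w (z + x)\<bar> \<partial>lborel) / ?c"
      by simp
    finally show "ennreal \<bar>w x - tent_mean h w x\<bar> \<le> (\<integral>\<^sup>+z. ennreal (tent h z / ?c * \<bar>w x - w (z + x)\<bar>) \<partial>lborel)"
      using pw[of x] by (simp add: ennreal_leI)
  qed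
  also have "\<dots> = (\<integral>\<^sup>+z. (\<integral>\<^sup>+x. ennreal (tent h z / ?c * \<bar>w x - w (z + x)\<bar>) \<partial>lborel) \<partial>lborel)"
    by (rule lborel_pair.Fubini') measurable
  also have "\<dots> \<le> (\<integral>\<^sup>+z. ennreal (tent h z / ?c * A) \<partial>(lborel :: 'a measure))"
  proof (rule nn_integral_mono)
    fix z :: 'a
    show "(\<integral>\<^sup>+x. ennreal (tent h z / ?c * \<bar>w x - w (z + x)\<bar>) \<partial>lborel) \<le> ennreal (tent h z / ?c * A)"
    proof (cases "norm z \<le> h")
      case True
      have "integrable lborel (\<lambda>x. w (z + x))"
        using integral_lborel_translate(2)[OF w] w_int by simp
      then have "(\<integral>\<^sup>+x. ennreal (tent h z / ?c * \<bar>w x - w (z + x)\<bar>) \<partial>lborel) =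
          ennreal (\<integral>x. tent h z / ?c * \<bar>w x - w (z + x)\<bar> \<partial>lborel)"
        using w_int c by (intro nn_integral_eq_integral) (auto simp: tent_nonneg)
      also have "(\<integral>x. tent h z / ?c * \<bar>w x - w (z + x)\<bar> \<partial>lborel) = tent h z / ?c * (\<integral>x. \<bar>w x - w (z + x)\<bar> \<partial>lborel)"
        by simp
      also have "ennreal \<dots> \<le> ennreal (tent h z / ?c * A)"
        using A(2)[OF True] c by (intro ennreal_leI mult_left_mono) (auto simp: tent_nonneg)
      finally show ?thesis .
    next
      case False
      then have "tent h z = 0" by (simp add: tent_def)
      then show ?thesis by simp
    qed
  qed
  also have "\<dots> = ennreal (\<integral>z. tent h z / ?c * A \<partial>(lborel :: 'a measure))"
    using A(1) c by (intro nn_integral_eq_integral) (auto simp: tent_nonneg integrable_tent)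
  also have "(\<integral>z. tent h z / ?c * A \<partial>(lborel :: 'a measure)) = A"
    using c by simp
  finally show ?thesis .
qed

text \<open>The means are equibounded and equi-Lipschitz, so Arzela--Ascoli makes them uniformly Cauchy
  along a subsequence. Of the three terms \<open>A\<close>, two bound the distances to the means and one the distance
  between the means.\<close>

lemma translation_bound_imp_L1_close_subsequence:
  fixes w :: "nat \<Rightarrow> 'a::euclidean_space \<Rightarrow> real"
  assumes h: "0 < h" and w [measurable]: "\<And>n. w n \<in> borel_measurable borel" and C: "\<And>n x. \<bar>w n x\<bar> \<le> C"
    and K: "compact K" "\<And>n x. x \<notin> K \<Longrightarrow> w n x = 0"
    and A: "0 < A" "\<And>n z. norm z \<le> h \<Longrightarrow> (\<integral>x. \<bar>w n x - w n (z + x)\<bar> \<partial>lborel) \<le> A"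
  shows "\<exists>k::nat \<Rightarrow> nat. strict_mono k \<and> (\<exists>N. \<forall>i\<ge>N. \<forall>j\<ge>N. (\<integral>x. \<bar>w (k i) x - w (k j) x\<bar> \<partial>lborel) \<le> 3 * A)"
proof -
  define L where "L = C * measure lborel K / (\<integral>z. tent h z \<partial>(lborel :: 'a measure))"
  have C0: "0 \<le> C" using C[of 0 0] by linarith
  have L: "0 \<le> L" using C0 integral_tent_pos[OF h, where 'a = 'a] by (simp add: L_def)
  have Lip: "\<bar>tent_mean h (w n) x - tent_mean h (w n) y\<bar> \<le> L * norm (x - y)" for n x y
    unfolding L_def by (rule tent_mean_Lipschitz[OF h w C K])
  have cont: "continuous_on UNIV (tent_mean h (w n))" for n
  proof (rule lipschitz_on_continuous_on[of L])
    show "L-lipschitz_on UNIV (tent_mean h (w n))"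
      using Lip L by (auto simp: lipschitz_on_def dist_norm)
  qed
  obtain g k where k: "strict_mono (k :: nat \<Rightarrow> nat)"
    and unif: "\<And>e. 0 < e \<Longrightarrow> \<exists>N. \<forall>n x. n \<ge> N \<and> x \<in> K \<longrightarrow> norm (tent_mean h (w (k n)) x - g x) < e"
  proof (rule Arzela_Ascoli[OF K(1), of "\<lambda>n. tent_mean h (w n)" C])
    show "norm (tent_mean h (w n) x) \<le> C" for n x
      using abs_tent_mean_le[OF h w C] by simp
    show "\<exists>d>0. \<forall>n y. y \<in> K \<and> norm (x - y) < d \<longrightarrow> norm (tent_mean h (w n) x - tent_mean h (w n) y) < e"
      if e: "0 < e" for x e
    proof (intro exI conjI allI impI)
      show "0 < e / (L + 1)" using e L by simp
      fix n y assume "y \<in> K \<and> norm (x - y) < e / (L + 1)"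
      then have "(L + 1) * norm (x - y) < e" using L by (simp add: pos_less_divide_eq mult.commute)
      moreover have "L * norm (x - y) \<le> (L + 1) * norm (x - y)" by (simp add: mult_right_mono)
      ultimately show "norm (tent_mean h (w n) x - tent_mean h (w n) y) < e"
        using Lip[of n x y] by simp
    qed
  qed blast
  define e where "e = A / (2 * (measure lborel K + 1))"
  have mK: "0 < measure lborel K + 1" by (rule add_nonneg_pos) auto
  have e: "0 < e" using A(1) mK by (simp add: e_def)
  have e_le: "2 * e * measure lborel K \<le> A"
  proof -
    have "2 * (A / (2 * m)) * m = A" if "0 < m" for m :: real
      using that by simp
    from this[OF mK] have "2 * e * (measure lborel K + 1) = A" by (simp only: e_def)
    then show ?thesis using e by (simp add: distrib_left)
  qed
  obtain N where N: "\<And>n x. n \<ge> N \<Longrightarrow> x \<in> K \<Longrightarrow> \<bar>tent_mean h (w (k n)) x - g x\<bar> < e"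
    using unif[OF e] by auto
  have "(\<integral>x. \<bar>w (k i) x - w (k j) x\<bar> \<partial>lborel) \<le> 3 * A" if ij: "i \<ge> N" "j \<ge> N" for i j
  proof -
    have [measurable]: "tent_mean h (w n) \<in> borel_measurable borel" for n
      using cont by (rule borel_measurable_continuous_onI)
    have Kfin: "emeasure lborel K = ennreal (measure lborel K)"
      using emeasure_compact_finite[OF K(1)] by (intro emeasure_eq_ennreal_measure) auto
    have [measurable]: "K \<in> sets borel" using K(1) by (rule borel_compact)
    have int: "integrable lborel (w n)" for n
      by (rule integrable_lborel_bounded_compact_support[OF w C K])
    have "ennreal (\<integral>x. \<bar>w (k i) x - w (k j) x\<bar> \<partial>lborel) = (\<integral>\<^sup>+x. ennreal \<bar>w (k i) x - w (k j) x\<bar> \<partial>lborel)"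
      using int by (intro nn_integral_eq_integral[symmetric]) auto
    also have "\<dots> \<le> (\<integral>\<^sup>+x. ennreal \<bar>w (k i) x - tent_mean h (w (k i)) x\<bar>
        + (ennreal \<bar>w (k j) x - tent_mean h (w (k j)) x\<bar> + ennreal (2 * e) * indicator K x) \<partial>lborel)"
    proof (rule nn_integral_mono)
      fix x
      show "ennreal \<bar>w (k i) x - w (k j) x\<bar> \<le> ennreal \<bar>w (k i) x - tent_mean h (w (k i)) x\<bar>
        + (ennreal \<bar>w (k j) x - tent_mean h (w (k j)) x\<bar> + ennreal (2 * e) * indicator K x)"
      proof (cases "x \<in> K")
        case True
        have "\<bar>w (k i) x - w (k j) x\<bar> \<le> \<bar>w (k i) x - tent_mean h (w (k i)) x\<bar>
            + (\<bar>w (k j) x - tent_mean h (w (k j)) x\<bar> + 2 * e)"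
          using N[OF ij(1) True] N[OF ij(2) True] by linarith
        then show ?thesis
          using True e by (simp flip: ennreal_plus)
      qed (use K(2) in simp)
    qed
    also have "\<dots> = (\<integral>\<^sup>+x. ennreal \<bar>w (k i) x - tent_mean h (w (k i)) x\<bar> \<partial>lborel)
        + ((\<integral>\<^sup>+x. ennreal \<bar>w (k j) x - tent_mean h (w (k j)) x\<bar> \<partial>lborel) + ennreal (2 * e) * emeasure lborel K)"
      by (simp add: nn_integral_add nn_integral_cmult)
    also have "\<dots> \<le> ennreal A + (ennreal A + ennreal A)"
    proof (intro add_mono)
      show "(\<integral>\<^sup>+x. ennreal \<bar>w n x - tent_mean h (w n) x\<bar> \<partial>lborel) \<le> ennreal A" for n
        by (rule tent_mean_L1_close[OF h w C K]) (use A in auto)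
      then show "(\<integral>\<^sup>+x. ennreal \<bar>w (k j) x - tent_mean h (w (k j)) x\<bar> \<partial>lborel) \<le> ennreal A" .
      show "ennreal (2 * e) * emeasure lborel K \<le> ennreal A"
        unfolding Kfin using e_le e by (simp flip: ennreal_mult'' add: ennreal_leI)
    qed
    also have "\<dots> = ennreal (3 * A)"
      using A(1) by (simp flip: ennreal_plus)
    finally show ?thesis
      using A(1) by (simp add: ennreal_le_iff)
  qed
  then show ?thesis using k by blast
qed

text \<open>The form of the Kolmogorov--Riesz theorem that is needed: a common modulus of continuity of
  translations in \<open>L\<^sup>1\<close> gives a subsequence that converges almost everywhere.\<close>

lemma translation_bound_imp_AE_Cauchy_subsequence:
  fixes w :: "nat \<Rightarrow> 'a::euclidean_space \<Rightarrow> real"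
  assumes h: "0 < h" and w: "\<And>n. w n \<in> borel_measurable borel" and C: "\<And>n x. \<bar>w n x\<bar> \<le> C"
    and K: "compact K" "\<And>n x. x \<notin> K \<Longrightarrow> w n x = 0"
    and R: "0 \<le> R" "\<And>n z. norm z \<le> h \<Longrightarrow> (\<integral>x. \<bar>w n x - w n (z + x)\<bar> \<partial>lborel) \<le> R * norm z"
  obtains r where "strict_mono (r :: nat \<Rightarrow> nat)" "AE x in lborel. Cauchy (\<lambda>i. w (r i) x)"
proof -
  \<comment> \<open>The radii \<open>t i\<close> tend to \<open>0\<close>; a diagonal subsequence is Cauchy in \<open>L\<^sup>1\<close>.\<close>
  define t where "t i = min h (1 / real (Suc i))" for i
  have t: "0 < t i" "t i \<le> h" "t i \<le> 1 / real (Suc i)" for i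
    using h by (auto simp: t_def)
  define P where "P i r \<longleftrightarrow> (\<exists>N. \<forall>a\<ge>N. \<forall>b\<ge>N. (\<integral>x. \<bar>w (r a) x - w (r b) x\<bar> \<partial>lborel) \<le> 3 * ((R + 1) * t i))"
    for i and r :: "nat \<Rightarrow> nat"
  obtain k where k: "strict_mono (k :: nat \<Rightarrow> nat)" "\<And>i. P i (id \<circ> k)"
  proof (rule subsequence_diagonalization_lemma[of P id])
    fix i and r :: "nat \<Rightarrow> nat"
    have "\<exists>k::nat \<Rightarrow> nat. strict_mono k \<and> (\<exists>N. \<forall>a\<ge>N. \<forall>b\<ge>N.
        (\<integral>x. \<bar>w (r (k a)) x - w (r (k b)) x\<bar> \<partial>lborel) \<le> 3 * ((R + 1) * t i))"
    proof (rule translation_bound_imp_L1_close_subsequence[OF t(1), of "\<lambda>n. w (r n)" C K])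
      show "0 < (R + 1) * t i" using R(1) t(1) by simp
      show "(\<integral>x. \<bar>w (r n) x - w (r n) (z + x)\<bar> \<partial>lborel) \<le> (R + 1) * t i" if z: "norm z \<le> t i" for n z
      proof -
        have "(\<integral>x. \<bar>w (r n) x - w (r n) (z + x)\<bar> \<partial>lborel) \<le> R * norm z"
          using R(2) z t(2) order_trans by blast
        also have "\<dots> \<le> (R + 1) * t i" using z R(1) by (intro mult_mono) auto
        finally show ?thesis .
      qed
    qed (use w C K in auto)
    then show "\<exists>k. strict_mono k \<and> P i (r \<circ> k)" by (simp add: P_def)
  next
    fix i and r k1 k2 :: "nat \<Rightarrow> nat" and N
    assume P1: "P i (r \<circ> k1)" and sub: "\<And>j. N \<le> j \<Longrightarrow> \<exists>j'\<ge>j. k2 j = k1 j'"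
    obtain N1 where N1: "\<And>a b. a \<ge> N1 \<Longrightarrow> b \<ge> N1 \<Longrightarrow>
        (\<integral>x. \<bar>w (r (k1 a)) x - w (r (k1 b)) x\<bar> \<partial>lborel) \<le> 3 * ((R + 1) * t i)"
      using P1 unfolding P_def by auto
    have "(\<integral>x. \<bar>w (r (k2 a)) x - w (r (k2 b)) x\<bar> \<partial>lborel) \<le> 3 * ((R + 1) * t i)"
      if ab: "a \<ge> max N N1" "b \<ge> max N N1" for a b
    proof -
      obtain a' b' where "a' \<ge> a" "k2 a = k1 a'" "b' \<ge> b" "k2 b = k1 b'"
        using sub[of a] sub[of b] ab by auto
      then show ?thesis using N1[of a' b'] ab by simp
    qed
    then show "P i (r \<circ> k2)"
      unfolding P_def o_def by blast
  qed blast
  have int: "integrable lborel (w n)" for n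
    by (rule integrable_lborel_bounded_compact_support[OF w C K])
  obtain s where s: "strict_mono s" "AE x in lborel. Cauchy (\<lambda>i. w (k (s i)) x)"
  proof (rule cauchy_L1_AE_cauchy_subseq[of lborel "\<lambda>n. w (k n)"])
    show "\<exists>N. \<forall>i\<ge>N. \<forall>j\<ge>N. (\<integral>x. norm (w (k i) x - w (k j) x) \<partial>lborel) < e" if e: "0 < e" for e
    proof -
      obtain i :: nat where i: "3 * (R + 1) / e < real (Suc i)"
        using reals_Archimedean2 by (metis less_Suc_eq of_nat_less_iff order_less_trans)
      have "3 * (R + 1) < e * real (Suc i)"
        using i e by (simp add: pos_divide_less_eq mult.commute)
      then have "3 * (R + 1) * (1 / real (Suc i)) < e"
        by (simp add: pos_divide_less_eq)
      moreover have "3 * (R + 1) * t i \<le> 3 * (R + 1) * (1 / real (Suc i))"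
        using t(3) R(1) by (intro mult_left_mono) auto
      ultimately have less: "3 * ((R + 1) * t i) < e" by (simp only: mult.assoc)
      obtain N where N: "\<forall>a\<ge>N. \<forall>b\<ge>N. (\<integral>x. \<bar>w (k a) x - w (k b) x\<bar> \<partial>lborel) \<le> 3 * ((R + 1) * t i)"
        using k(2)[of i] unfolding P_def by auto
      have "(\<integral>x. norm (w (k a) x - w (k b) x) \<partial>lborel) < e" if "a \<ge> N" "b \<ge> N" for a b
        using N that less unfolding real_norm_def by (blast intro: order_le_less_trans)
      then show ?thesis by blast
    qed
  qed (use int in auto)
  show ?thesis
    using that[OF strict_mono_o[OF k(1) s(1)]] s(2) by (simp add: o_def)
qed

section \<open>Almost everywhere convergence and compactness in Lp spaces\<close>

lemma AE_bounded_integrable_powr: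
  fixes f :: "'a::euclidean_space \<Rightarrow> real"
  assumes U: "U \<in> lmeasurable" and p: "0 \<le> p"
    and f: "f \<in> borel_measurable (lebesgue_on U)" "AE x in lebesgue_on U. \<bar>f x\<bar> \<le> M"
  shows "integrable (lebesgue_on U) (\<lambda>x. \<bar>f x\<bar> powr p)"
proof -
  have "finite_measure (lebesgue_on U)"
    using U by (rule finite_measure_lebesgue_on)
  then show ?thesis
  proof (rule finite_measure.integrable_const_bound[where B = "M powr p"])
    show "AE x in lebesgue_on U. norm (\<bar>f x\<bar> powr p) \<le> M powr p"
      using f(2) by (rule eventually_mono) (auto intro: powr_mono2 p)
    show "(\<lambda>x. \<bar>f x\<bar> powr p) \<in> borel_measurable (lebesgue_on U)"
      using f(1) by measurable
  qed
qed

lemma AE_tendsto_imp_Lp_norm_tendsto_0: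
  fixes f :: "nat \<Rightarrow> 'a::euclidean_space \<Rightarrow> real"
  assumes U: "U \<in> lmeasurable" and p: "1 \<le> p"
    and f: "\<And>n. f n \<in> borel_measurable (lebesgue_on U)" "\<And>n. AE x in lebesgue_on U. \<bar>f n x\<bar> \<le> M"
    and l: "l \<in> borel_measurable (lebesgue_on U)" "AE x in lebesgue_on U. \<bar>l x\<bar> \<le> M"
    and lim: "AE x in lebesgue_on U. (\<lambda>n. f n x) \<longlonglongrightarrow> l x"
  shows "(\<lambda>n. Lp_norm p U (\<lambda>x. f n x - l x)) \<longlonglongrightarrow> 0"
proof -
  note [measurable] = f(1) l(1)
  interpret finite_measure "lebesgue_on U"
    using U by (rule finite_measure_lebesgue_on)
  have "(\<lambda>n. \<integral>x. \<bar>f n x - l x\<bar> powr p \<partial>lebesgue_on U) \<longlonglongrightarrow> (\<integral>x. 0 \<partial>lebesgue_on U)"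
  proof (rule integral_dominated_convergence[where w = "\<lambda>x. (2 * M) powr p"])
    show "AE x in lebesgue_on U. (\<lambda>n. \<bar>f n x - l x\<bar> powr p) \<longlonglongrightarrow> 0"
      using lim
    proof (rule eventually_mono)
      fix x assume "(\<lambda>n. f n x) \<longlonglongrightarrow> l x"
      then have "(\<lambda>n. \<bar>f n x - l x\<bar>) \<longlonglongrightarrow> 0"
        by (simp add: LIM_zero_iff tendsto_rabs_zero_iff)
      then have "(\<lambda>n. \<bar>f n x - l x\<bar> powr p) \<longlonglongrightarrow> 0 powr p"
        using p by (intro tendsto_powr') auto
      then show "(\<lambda>n. \<bar>f n x - l x\<bar> powr p) \<longlonglongrightarrow> 0"
        using p by simp
    qed
    show "AE x in lebesgue_on U. norm (\<bar>f n x - l x\<bar> powr p) \<le> (2 * M) powr p" for n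
      using f(2)[of n] l(2)
    proof (rule eventually_elim2)
      fix x assume "\<bar>f n x\<bar> \<le> M" "\<bar>l x\<bar> \<le> M"
      then have "\<bar>f n x - l x\<bar> \<le> 2 * M" by linarith
      then show "norm (\<bar>f n x - l x\<bar> powr p) \<le> (2 * M) powr p"
        using p by (simp add: powr_mono2)
    qed
  qed auto
  then have "(\<lambda>n. \<integral>x. \<bar>f n x - l x\<bar> powr p \<partial>lebesgue_on U) \<longlonglongrightarrow> 0"
    by simp
  then have "(\<lambda>n. (\<integral>x. \<bar>f n x - l x\<bar> powr p \<partial>lebesgue_on U) powr (1 / p)) \<longlonglongrightarrow> 0 powr (1 / p)"
    using p by (intro tendsto_powr') auto
  then show ?thesis by (simp add: Lp_norm_def)
qed

text \<open>For uniformly bounded functions on a set of finite measure, almost everywhere convergence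
  implies convergence in every \<open>L\<^sup>p\<close>.\<close>

lemma AE_subsequences_imp_compactin_Lp:
  fixes X :: "('a::euclidean_space \<Rightarrow> real) set"
  assumes U: "U \<in> lmeasurable" and p: "1 \<le> p"
    and X: "\<And>f. f \<in> X \<Longrightarrow> f \<in> borel_measurable (lebesgue_on U)"
      "\<And>f. f \<in> X \<Longrightarrow> AE x in lebesgue_on U. \<bar>f x\<bar> \<le> M"
    and sub: "\<And>f. (\<And>n. f n \<in> X) \<Longrightarrow>
      \<exists>l\<in>X. \<exists>r. strict_mono (r :: nat \<Rightarrow> nat) \<and> (AE x in lebesgue_on U. (\<lambda>n. f (r n) x) \<longlonglongrightarrow> l x)"
  shows "compactin (Lp_topology p U) (X // ae_eq U)"
proof -
  interpret Metric_space "Lp_space p U" "Lp_dist p U"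
    using p by (rule Metric_space_Lp)
  have XL: "f \<in> Lp_fun p U" if "f \<in> X" for f
    using AE_bounded_integrable_powr[OF U _ X[OF that], of p] X(1)[OF that] p by (simp add: Lp_fun_def)
  have mem: "ae_eq U `` {f} \<in> Lp_space p U" if "f \<in> X" for f
    using XL[OF that] unfolding Lp_space_def by (rule quotientI)
  show ?thesis
    unfolding Lp_topology_def compactin_sequentially
  proof (intro conjI allI impI)
    show "X // ae_eq U \<subseteq> Lp_space p U"
      using mem by (auto elim!: quotientE)
    fix \<sigma> :: "nat \<Rightarrow> ('a \<Rightarrow> real) set" assume \<sigma>: "range \<sigma> \<subseteq> X // ae_eq U"
    have "\<exists>f. f \<in> X \<and> \<sigma> n = ae_eq U `` {f}" for n
    proof -
      have "\<sigma> n \<in> X // ae_eq U" using \<sigma> by blast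
      then show ?thesis by (auto elim!: quotientE)
    qed
    then obtain f where f: "\<And>n. f n \<in> X" "\<And>n. \<sigma> n = ae_eq U `` {f n}"
      by metis
    obtain l r where l: "l \<in> X" and r: "strict_mono (r :: nat \<Rightarrow> nat)"
      and lim: "AE x in lebesgue_on U. (\<lambda>n. f (r n) x) \<longlonglongrightarrow> l x"
      using sub[of f] f(1) by blast
    have "(\<lambda>n. Lp_norm p U (\<lambda>x. f (r n) x - l x)) \<longlonglongrightarrow> 0"
      by (rule AE_tendsto_imp_Lp_norm_tendsto_0[OF U p X(1)[OF f(1)] X(2)[OF f(1)] X(1)[OF l] X(2)[OF l] lim])
    moreover have "Lp_norm p U (\<lambda>x. f (r n) x - l x) = Lp_dist p U ((\<sigma> \<circ> r) n) (ae_eq U `` {l})" for n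
      using Lp_dist_class[OF XL[OF f(1)] XL[OF l]] by (simp add: f(2))
    ultimately have "(\<lambda>n. Lp_dist p U ((\<sigma> \<circ> r) n) (ae_eq U `` {l})) \<longlonglongrightarrow> 0"
      by simp
    then have "limitin mtopology (\<sigma> \<circ> r) (ae_eq U `` {l}) sequentially"
      using mem f l unfolding limitin_metric_dist_null by auto
    then show "\<exists>l r. l \<in> X // ae_eq U \<and> strict_mono r \<and> limitin mtopology (\<sigma> \<circ> r) l sequentially"
      using r quotientI[OF l] by blast
  qed
qed

section \<open>The class of bounded coefficients\<close>

lemma Gam'_abs_le:
  assumes "\<gamma> \<in> Gam' m M U V" "0 < m"
  shows "AE x in lebesgue_on U. \<bar>\<gamma> x\<bar> \<le> M"
proof -
  have "AE x in lebesgue_on U. m \<le> \<gamma> x \<and> \<gamma> x \<le> M"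
    using assms by (auto simp: Gam'_def Gam_def)
  then show ?thesis
    by (rule eventually_mono) (use assms(2) in auto)
qed

lemma Gam'_measurable: "\<gamma> \<in> Gam' m M U V \<Longrightarrow> \<gamma> \<in> borel_measurable (lebesgue_on U)"
  by (auto simp: Gam'_def Gam_def Linf_fun_def)

lemma AE_lebesgue_on_iff:
  "U \<in> sets lebesgue \<Longrightarrow> (AE x in lebesgue_on U. P x) \<longleftrightarrow> (AE x in lebesgue. x \<in> U \<longrightarrow> P x)"
  by (rule AE_restrict_space_iff) simp

lemma Gam'_AE_limit:
  assumes U: "U \<in> sets lebesgue" "V \<in> sets lebesgue" and m: "0 < m"
    and \<gamma>: "\<And>n. \<gamma> n \<in> Gam' m M U V" and l: "l \<in> borel_measurable (lebesgue_on U)"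
    and lim: "AE x in lebesgue_on U. (\<lambda>n. \<gamma> n x) \<longlonglongrightarrow> l x"
  shows "l \<in> Gam' m M U V"
proof -
  have "AE x in lebesgue_on U. \<forall>n. m \<le> \<gamma> n x \<and> \<gamma> n x \<le> M"
    using \<gamma> by (subst AE_all_countable) (auto simp: Gam'_def Gam_def)
  with lim have b: "AE x in lebesgue_on U. m \<le> l x \<and> l x \<le> M"
    by (rule eventually_elim2) (auto intro: LIMSEQ_le_const LIMSEQ_le_const2)
  then have "AE x in lebesgue_on U. \<bar>l x\<bar> \<le> M"
    by (rule eventually_mono) (use m in auto)
  with b l have "l \<in> Gam m M U"
    unfolding Gam_def Linf_fun_def by blast
  moreover have "AE x in lebesgue_on (U - V). l x = 1"
  proof -
    have "AE x in lebesgue_on (U - V). \<forall>n. \<gamma> n x = 1"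
      using \<gamma> by (subst AE_all_countable) (auto simp: Gam'_def)
    then have "AE x in lebesgue. x \<in> U - V \<longrightarrow> (\<forall>n. \<gamma> n x = 1)"
      using U by (subst (asm) AE_lebesgue_on_iff) auto
    moreover have "AE x in lebesgue. x \<in> U \<longrightarrow> (\<lambda>n. \<gamma> n x) \<longlonglongrightarrow> l x"
      using lim U by (subst (asm) AE_lebesgue_on_iff) auto
    ultimately have "AE x in lebesgue. x \<in> U - V \<longrightarrow> l x = 1"
    proof (rule eventually_elim2)
      fix x assume *: "x \<in> U - V \<longrightarrow> (\<forall>n. \<gamma> n x = 1)" "x \<in> U \<longrightarrow> (\<lambda>n. \<gamma> n x) \<longlonglongrightarrow> l x"
      show "x \<in> U - V \<longrightarrow> l x = 1"
      proof
        assume x: "x \<in> U - V"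
        then have "(\<lambda>n. 1) \<longlonglongrightarrow> l x" using * by simp
        then show "l x = 1" by (simp add: LIMSEQ_const_iff)
      qed
    qed
    then show ?thesis
      using U by (subst AE_lebesgue_on_iff) auto
  qed
  ultimately show ?thesis by (simp add: Gam'_def)
qed

text \<open>A genuine Borel function that represents \<open>\<gamma> - 1\<close> and is bounded, and zero off the closure
  of \<open>V\<close>, at every point: translations and iterated integrals can then be taken for Lebesgue--Borel
  measure.\<close>

lemma Gam'_borel_representative:
  fixes \<gamma> :: "real^'n \<Rightarrow> real"
  assumes U: "open U" "open V" "closure V \<subseteq> U" and m: "0 < m" "max 1 m \<le> M" and \<gamma>: "\<gamma> \<in> Gam' m M U V"
  obtains w where "w \<in> borel_measurable borel" "\<And>x. \<bar>w x\<bar> \<le> M + 1" "\<And>x. x \<notin> closure V \<Longrightarrow> w x = 0"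
    "AE x in lebesgue_on U. \<gamma> x = 1 + w x"
proof -
  have Us: "U \<in> sets lebesgue" "U - V \<in> sets lebesgue"
    using U by auto
  have "(\<lambda>x. indicator U x *\<^sub>R (\<gamma> x - 1)) \<in> borel_measurable lebesgue"
    using Gam'_measurable[OF \<gamma>] Us(1)
    by (subst borel_measurable_restrict_space_iff[symmetric]) auto
  from completion_ex_borel_measurable_real[OF this]
  obtain w0 where [measurable]: "w0 \<in> borel_measurable borel"
    and w0: "AE x in lborel. indicator U x *\<^sub>R (\<gamma> x - 1) = w0 x"
    by auto
  define w where "w x = indicator (closure V) x * max (- (M + 1)) (min (M + 1) (w0 x))" for x
  show ?thesis
  proof
    show "w \<in> borel_measurable borel" unfolding w_def by measurable
    show "\<bar>w x\<bar> \<le> M + 1" for x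
      using m by (auto simp: w_def indicator_def)
    show "w x = 0" if "x \<notin> closure V" for x
      using that by (simp add: w_def)
    have "AE x in lebesgue. x \<in> U \<longrightarrow> m \<le> \<gamma> x \<and> \<gamma> x \<le> M"
      using \<gamma> Us by (subst AE_lebesgue_on_iff[symmetric]) (auto simp: Gam'_def Gam_def)
    moreover have "AE x in lebesgue. x \<in> U - V \<longrightarrow> \<gamma> x = 1"
      using \<gamma> Us by (subst AE_lebesgue_on_iff[symmetric]) (auto simp: Gam'_def)
    moreover have "AE x in lebesgue. indicator U x *\<^sub>R (\<gamma> x - 1) = w0 x"
      using w0 by (rule AE_completion)
    ultimately have "AE x in lebesgue. x \<in> U \<longrightarrow> \<gamma> x = 1 + w x"
    proof eventually_elim
      case (elim x)
      show ?case
      proof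
        assume x: "x \<in> U"
        then have "w0 x = \<gamma> x - 1" "\<bar>\<gamma> x - 1\<bar> \<le> M + 1"
          using elim m by auto
        moreover have "\<gamma> x = 1" if "x \<notin> closure V"
          using that x elim(2) closure_subset[of V] by blast
        ultimately show "\<gamma> x = 1 + w x"
          by (auto simp: w_def indicator_def abs_le_iff)
      qed
    qed
    then show "AE x in lebesgue_on U. \<gamma> x = 1 + w x"
      using Us by (subst AE_lebesgue_on_iff)
  qed
qed

section \<open>Subsequences of functions of bounded variation\<close>

lemma test_field_continuous_divergence:
  assumes "\<phi> \<in> test_fields U"
  shows "continuous_on UNIV (divergence \<phi>)"
proof -
  have "smooth_on UNIV \<phi>" using assms by (simp add: test_fields_def)
  then show ?thesis
    unfolding divergence_def[abs_def] partial_def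
    by (intro continuous_on_sum continuous_on_component smooth_on_UNIV_continuous_frechet_derivative)
qed

text \<open>Lower semicontinuity of the \<open>BV\<close> norm along bounded sequences that converge almost everywhere.\<close>

lemma BV_norm_AE_limit:
  fixes f :: "nat \<Rightarrow> real^'n \<Rightarrow> real"
  assumes U: "U \<in> lmeasurable" "bounded U"
    and f: "\<And>n. f n \<in> borel_measurable (lebesgue_on U)" "\<And>n. AE x in lebesgue_on U. \<bar>f n x\<bar> \<le> M"
    and l: "l \<in> borel_measurable (lebesgue_on U)" "AE x in lebesgue_on U. \<bar>l x\<bar> \<le> M"
    and lim: "AE x in lebesgue_on U. (\<lambda>n. f n x) \<longlonglongrightarrow> l x"
    and norm: "\<And>n. BV_norm U (f n) \<le> ereal R"
  shows "l \<in> BV U" "BV_norm U l \<le> ereal R"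
proof -
  note [measurable] = f(1) l(1)
  interpret finite_measure "lebesgue_on U"
    using U(1) by (rule finite_measure_lebesgue_on)
  have Us: "U \<in> sets lebesgue" using U(1) by (rule fmeasurableD)
  have limit: "(\<lambda>n. \<integral>x. f n x * h x \<partial>lebesgue_on U) \<longlonglongrightarrow> (\<integral>x. l x * h x \<partial>lebesgue_on U)"
    if h: "continuous_on UNIV h" for h
  proof (rule integral_dominated_convergence[where w = "\<lambda>x. M * \<bar>h x\<bar>"])
    have hm: "h \<in> borel_measurable (lebesgue_on U)"
      by (intro continuous_imp_measurable_on_sets_lebesgue Us continuous_on_subset[OF h]) auto
    then show "(\<lambda>x. l x * h x) \<in> borel_measurable (lebesgue_on U)"
      "(\<lambda>x. f n x * h x) \<in> borel_measurable (lebesgue_on U)" for n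
      by measurable
    show "integrable (lebesgue_on U) (\<lambda>x. M * \<bar>h x\<bar>)"
      by (intro integrable_mult_continuous integrable_const U Us continuous_on_rabs h)
    show "AE x in lebesgue_on U. (\<lambda>n. f n x * h x) \<longlonglongrightarrow> l x * h x"
      using lim by (rule eventually_mono) (intro tendsto_intros)
    show "AE x in lebesgue_on U. norm (f n x * h x) \<le> M * \<bar>h x\<bar>" for n
      using f(2)[of n] by (rule eventually_mono) (simp add: abs_mult mult_right_mono)
  qed
  have "variation U l \<le> ereal R"
    unfolding variation_def
  proof (rule SUP_least)
    fix \<phi> assume \<phi>: "\<phi> \<in> {\<phi> \<in> test_fields U. AE x in lebesgue_on U. norm (\<phi> x) \<le> 1}"
    have "(\<integral>x. f n x * divergence \<phi> x \<partial>lebesgue_on U) \<le> R" for n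
    proof -
      have "ereal (\<integral>x. f n x * divergence \<phi> x \<partial>lebesgue_on U) \<le> variation U (f n)"
        unfolding variation_def using \<phi> by (rule SUP_upper)
      also have "\<dots> \<le> ereal R" using norm[of n] by (simp add: BV_norm_def)
      finally show ?thesis by simp
    qed
    then have "(\<integral>x. l x * divergence \<phi> x \<partial>lebesgue_on U) \<le> R"
      using \<phi> by (intro LIMSEQ_le_const2[OF limit[OF test_field_continuous_divergence[of \<phi> U]]]) auto
    then show "ereal (\<integral>x. l x * divergence \<phi> x \<partial>lebesgue_on U) \<le> ereal R" by simp
  qed
  moreover have "(\<integral>x. \<bar>l x\<bar> \<partial>lebesgue_on U) \<le> R"
  proof (rule LIMSEQ_le_const2)
    show "(\<lambda>n. \<integral>x. \<bar>f n x\<bar> \<partial>lebesgue_on U) \<longlonglongrightarrow> (\<integral>x. \<bar>l x\<bar> \<partial>lebesgue_on U)"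
    proof (rule integral_dominated_convergence[where w = "\<lambda>x. M"])
      show "AE x in lebesgue_on U. (\<lambda>n. \<bar>f n x\<bar>) \<longlonglongrightarrow> \<bar>l x\<bar>"
        using lim by (rule eventually_mono) (rule tendsto_rabs)
    qed (use f(2) in auto)
    show "\<exists>N. \<forall>n\<ge>N. (\<integral>x. \<bar>f n x\<bar> \<partial>lebesgue_on U) \<le> R"
      using norm by (auto simp: BV_norm_def)
  qed
  ultimately show "BV_norm U l \<le> ereal R" by (simp add: BV_norm_def)
  have "integrable (lebesgue_on U) l"
    using l by (intro integrable_const_bound[of _ M]) auto
  then show "l \<in> BV U"
    using \<open>variation U l \<le> ereal R\<close> by (auto simp: BV_def order_le_less_trans)
qed

lemma X_BV_AE_convergent_subsequence:
  fixes U V :: "(real^'n) set" and \<gamma> :: "nat \<Rightarrow> real^'n \<Rightarrow> real"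
  assumes U: "open U" "bounded U" "open V" "closure V \<subseteq> U" and m: "0 < m" "max 1 m \<le> M" and R: "0 \<le> R"
    and \<gamma>: "\<And>n. \<gamma> n \<in> X_BV m M U V R"
  shows "\<exists>l\<in>X_BV m M U V R. \<exists>r. strict_mono (r :: nat \<Rightarrow> nat) \<and>
    (AE x in lebesgue_on U. (\<lambda>n. \<gamma> (r n) x) \<longlonglongrightarrow> l x)"
proof -
  have \<gamma>G: "\<gamma> n \<in> Gam' m M U V" and \<gamma>N: "BV_norm U (\<gamma> n) \<le> ereal R" and \<gamma>I: "integrable (lebesgue_on U) (\<gamma> n)" for n
    using \<gamma>[of n] by (auto simp: X_BV_def BV_def)
  have Us: "U \<in> sets lebesgue" "V \<in> sets lebesgue" "U \<in> lmeasurable"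
    using U by (auto intro: lmeasurable_open)
  have "\<exists>w. w \<in> borel_measurable borel \<and> (\<forall>x. \<bar>w x\<bar> \<le> M + 1) \<and> (\<forall>x. x \<notin> closure V \<longrightarrow> w x = 0) \<and>
      (AE x in lebesgue_on U. \<gamma> n x = 1 + w x)" for n
    by (rule Gam'_borel_representative[OF U(1,3,4) m \<gamma>G[of n]]) blast
  then obtain w where w: "\<And>n. w n \<in> borel_measurable borel" "\<And>n x. \<bar>w n x\<bar> \<le> M + 1"
      "\<And>n x. x \<notin> closure V \<Longrightarrow> w n x = 0" "\<And>n. AE x in lebesgue_on U. \<gamma> n x = 1 + w n x"
    by metis
  note [measurable] = w(1)
  have K: "compact (closure V)"
    using U(2,4) by (meson bounded_closure bounded_subset closure_subset compact_closure order_trans)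
  obtain e where e: "0 < e" "(\<Union>x\<in>closure V. cball x e) \<subseteq> U"
    using compact_subset_open_imp_cball_epsilon_subset[OF K U(1,4)] by metis
  have trans: "(\<integral>x. \<bar>w n x - w n (z + x)\<bar> \<partial>lborel) \<le> R * norm z" if z: "norm z \<le> e / 4" for n z
  proof (rule variation_imp_translation_L1_le[OF U(2) Us(1) R \<gamma>I _ w(1,2,4) K w(3)])
    show "variation U (\<gamma> n) \<le> ereal R" using \<gamma>N[of n] by (simp add: BV_norm_def)
    show "0 < e / 4" "norm z \<le> e / 4" "(\<Union>x\<in>closure V. cball x (4 * (e / 4))) \<subseteq> U"
      using e z by auto
  qed
  have e4: "0 < e / 4" using e by simp
  obtain r where r: "strict_mono (r :: nat \<Rightarrow> nat)" "AE x in lborel. Cauchy (\<lambda>i. w (r i) x)"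
    by (rule translation_bound_imp_AE_Cauchy_subsequence[OF e4 w(1,2) K w(3) R trans])
  \<comment> \<open>The arbitrary value of \<^const>\<open>lim\<close> at points without convergence matters only on a null set.\<close>
  define l where "l x = 1 + lim (\<lambda>i. w (r i) x)" for x
  have "l \<in> borel_measurable borel"
    unfolding l_def by measurable
  then have l: "l \<in> borel_measurable (lebesgue_on U)"
    by (intro measurable_restrict_space1 measurable_completion) simp
  have lim: "AE x in lebesgue_on U. (\<lambda>n. \<gamma> (r n) x) \<longlonglongrightarrow> l x"
  proof -
    have "AE x in lebesgue. Cauchy (\<lambda>i. w (r i) x)"
      using r(2) by (rule AE_completion)
    then have "AE x in lebesgue_on U. Cauchy (\<lambda>i. w (r i) x)"
      using Us by (subst AE_lebesgue_on_iff) auto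
    moreover have "AE x in lebesgue_on U. \<forall>n. \<gamma> n x = 1 + w n x"
      using w(4) by (subst AE_all_countable) auto
    ultimately show ?thesis
    proof (rule eventually_elim2)
      fix x assume "Cauchy (\<lambda>i. w (r i) x)" "\<forall>n. \<gamma> n x = 1 + w n x"
      then show "(\<lambda>n. \<gamma> (r n) x) \<longlonglongrightarrow> l x"
        unfolding l_def by (auto intro!: tendsto_intros simp: Cauchy_convergent_iff convergent_LIMSEQ_iff)
    qed
  qed
  have lG: "l \<in> Gam' m M U V"
    using Gam'_AE_limit[OF Us(1,2) m(1) _ l lim] \<gamma>G by blast
  have "l \<in> BV U" "BV_norm U l \<le> ereal R"
    using BV_norm_AE_limit[OF Us(3) U(2) _ _ l Gam'_abs_le[OF lG m(1)] lim \<gamma>N]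
      Gam'_measurable[OF \<gamma>G] Gam'_abs_le[OF \<gamma>G m(1)] by blast+
  then have "l \<in> X_BV m M U V R"
    using lG by (simp add: X_BV_def)
  then show ?thesis using r(1) lim by blast
qed

section \<open>Subsequences of functions with Hoelder continuous gradient\<close>

lemma frechet_derivative_eq_sum_partial:
  fixes v :: "real^'n \<Rightarrow> real"
  assumes "v differentiable (at x)"
  shows "frechet_derivative v (at x) u = (\<Sum>i\<in>UNIV. u $ i * partial i v x)"
  unfolding partial_def by (rule linear_eq_sum_axis[OF linear_frechet_derivative[OF assms]])

lemma abs_sum_components_le:
  fixes u :: "real^'n"
  assumes "\<And>i. \<bar>c i\<bar> \<le> B"
  shows "\<bar>\<Sum>i\<in>UNIV. u $ i * c i\<bar> \<le> real CARD('n) * B * norm u"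
proof -
  have "\<bar>\<Sum>i\<in>UNIV. u $ i * c i\<bar> \<le> (\<Sum>i\<in>(UNIV::'n set). norm u * B)"
  proof (intro order_trans[OF sum_abs] sum_mono)
    show "\<bar>u $ i * c i\<bar> \<le> norm u * B" for i
      unfolding abs_mult using assms[of i] by (intro mult_mono component_le_norm_cart) auto
  qed
  then show ?thesis by (simp add: mult_ac)
qed

lemma C1_holder_norm_le_iff:
  fixes U :: "(real^'n) set"
  shows "C1_holder_norm \<alpha> U v \<le> ereal R \<longleftrightarrow>
    (\<forall>x\<in>U. \<bar>v x\<bar> \<le> R) \<and> (\<forall>i. \<forall>x\<in>U. \<bar>partial i v x\<bar> \<le> R) \<and>
    (\<forall>i. \<forall>x\<in>U. \<forall>y\<in>U. x \<noteq> y \<longrightarrow> \<bar>partial i v x - partial i v y\<bar> / dist x y powr \<alpha> \<le> R)"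
  unfolding C1_holder_norm_def C1_norm_def holder_seminorm_def
  by (auto simp: SUP_le_iff)

lemma AE_eq_imp_eq_on_open:
  fixes v :: "'a::euclidean_space \<Rightarrow> real"
  assumes W: "open W" "continuous_on W v" "AE x in lebesgue. x \<in> W \<longrightarrow> v x = c" and x: "x \<in> W"
  shows "v x = c"
proof (rule ccontr)
  assume "v x \<noteq> c"
  have "open (W \<inter> v -` (- {c}))"
    using W(1,2) by (intro continuous_open_preimage) auto
  moreover have "W \<inter> v -` (- {c}) \<noteq> {}" using x \<open>v x \<noteq> c\<close> by auto
  ultimately have "\<not> negligible (W \<inter> v -` (- {c}))"
    using open_not_negligible by blast
  moreover have "negligible (W \<inter> v -` (- {c}))"
  proof -
    have "AE x in lebesgue. x \<notin> W \<inter> v -` (- {c})"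
      using W(3) by (rule eventually_mono) auto
    moreover have "W \<inter> v -` (- {c}) \<in> sets lebesgue"
      using \<open>open (W \<inter> v -` (- {c}))\<close> by auto
    ultimately show ?thesis
      by (simp add: negligible_iff_null_sets AE_iff_null_sets)
  qed
  ultimately show False by blast
qed

text \<open>A member of \<^const>\<open>X_C1\<close> is continuous, so it equals \<open>1\<close> everywhere, and not only almost
  everywhere, on the part of \<open>U\<close> outside the closure of \<open>V\<close>.\<close>

lemma X_C1_D:
  fixes U V :: "(real^'n) set"
  assumes U: "open U" "open V" "closure V \<subseteq> U" and v: "v \<in> X_C1 \<alpha> m M U V R"
  shows "v \<in> Gam' m M U V"
    and "\<And>x. x \<in> U \<Longrightarrow> v differentiable (at x)"
    and "\<And>x. x \<in> U \<Longrightarrow> \<bar>v x\<bar> \<le> R" "\<And>i x. x \<in> U \<Longrightarrow> \<bar>partial i v x\<bar> \<le> R"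
    and "\<And>i x y. x \<in> U \<Longrightarrow> y \<in> U \<Longrightarrow> x \<noteq> y \<Longrightarrow> \<bar>partial i v x - partial i v y\<bar> / dist x y powr \<alpha> \<le> R"
    and "\<And>x. x \<in> U - closure V \<Longrightarrow> v x = 1"
    and "\<And>i x. x \<in> U - closure V \<Longrightarrow> partial i v x = 0"
proof -
  show G: "v \<in> Gam' m M U V" and "\<And>x. x \<in> U \<Longrightarrow> v differentiable (at x)"
    and "\<And>x. x \<in> U \<Longrightarrow> \<bar>v x\<bar> \<le> R" "\<And>i x. x \<in> U \<Longrightarrow> \<bar>partial i v x\<bar> \<le> R"
    and "\<And>i x y. x \<in> U \<Longrightarrow> y \<in> U \<Longrightarrow> x \<noteq> y \<Longrightarrow> \<bar>partial i v x - partial i v y\<bar> / dist x y powr \<alpha> \<le> R"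
    using v by (auto simp: X_C1_def C1_holder_def C1_holder_norm_le_iff)
  have diff: "\<And>x. x \<in> U \<Longrightarrow> v differentiable (at x)" by fact
  have W: "open (U - closure V)" using U(1) by (simp add: open_Diff)
  have cont: "continuous_on (U - closure V) v"
    using diff by (intro continuous_at_imp_continuous_on) (auto intro: differentiable_imp_continuous_within)
  have "AE x in lebesgue. x \<in> U - V \<longrightarrow> v x = 1"
    using G U by (subst AE_lebesgue_on_iff[symmetric]) (auto simp: Gam'_def)
  then have "AE x in lebesgue. x \<in> U - closure V \<longrightarrow> v x = 1"
    by (rule eventually_mono) (use closure_subset in auto)
  then show one: "v x = 1" if "x \<in> U - closure V" for x
    using AE_eq_imp_eq_on_open[OF W cont] that by blast
  show "partial i v x = 0" if x: "x \<in> U - closure V" for i x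
  proof -
    have "((\<lambda>x. 1) has_derivative (\<lambda>u. 0)) (at x)" by simp
    then have "(v has_derivative (\<lambda>u. 0)) (at x)"
      by (rule has_derivative_transform_within_open[OF _ W x]) (simp add: one)
    from frechet_derivative_at[OF this, symmetric] show ?thesis
      by (simp add: partial_def)
  qed
qed

lemma bounded_partials_imp_Lipschitz_on_ball:
  fixes v :: "real^'n \<Rightarrow> real"
  assumes "\<And>x. x \<in> ball a r \<Longrightarrow> v differentiable (at x)" "\<And>i x. x \<in> ball a r \<Longrightarrow> \<bar>partial i v x\<bar> \<le> R"
    and xy: "x \<in> ball a r" "y \<in> ball a r"
  shows "\<bar>v x - v y\<bar> \<le> real CARD('n) * R * norm (x - y)"
proof -
  have "norm (v x - v y) \<le> (real CARD('n) * R) * norm (x - y)"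
  proof (rule differentiable_bound[OF convex_ball])
    fix z assume z: "z \<in> ball a r"
    show "(v has_derivative frechet_derivative v (at z)) (at z within ball a r)"
      using assms(1)[OF z] by (simp add: frechet_derivative_works has_derivative_at_withinI)
    show "onorm (frechet_derivative v (at z)) \<le> real CARD('n) * R"
      using abs_sum_components_le[of "\<lambda>i. partial i v z" R] assms(2)[OF z]
      by (intro onorm_le) (simp add: frechet_derivative_eq_sum_partial[OF assms(1)[OF z]])
  qed (use xy in auto)
  then show ?thesis by simp
qed

text \<open>Functions and gradients are equicontinuous on the compact set \<open>closure V\<close>, and constant on the
  rest of \<open>U\<close>, so that a subsequence converges uniformly on \<open>U\<close> together with the gradients. No
  regularity of the boundary of \<open>U\<close> enters: near it the limit is \<open>1\<close>.\<close>

lemma X_C1_AE_convergent_subsequence: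
  fixes U V :: "(real^'n) set" and \<gamma> :: "nat \<Rightarrow> real^'n \<Rightarrow> real"
  assumes U: "open U" "bounded U" "open V" "closure V \<subseteq> U" and m: "0 < m" and R: "0 < R" and \<alpha>: "0 < \<alpha>"
    and \<gamma>: "\<And>n. \<gamma> n \<in> X_C1 \<alpha> m M U V R"
  shows "\<exists>l\<in>X_C1 \<alpha> m M U V R. \<exists>r. strict_mono (r :: nat \<Rightarrow> nat) \<and>
    (AE x in lebesgue_on U. (\<lambda>n. \<gamma> (r n) x) \<longlonglongrightarrow> l x)"
proof -
  let ?K = "closure V" and ?n = "real CARD('n)"
  note D = X_C1_D[OF U(1,3,4) \<gamma>]
  have K: "compact ?K"
    using U(2,4) by (meson bounded_closure bounded_subset closure_subset compact_closure order_trans)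
  define F where "F n x = (\<gamma> n x, \<chi> i. partial i (\<gamma> n) x)" for n x
  obtain g r where r: "strict_mono (r :: nat \<Rightarrow> nat)"
    and unif: "\<And>e. 0 < e \<Longrightarrow> \<exists>N. \<forall>n x. n \<ge> N \<and> x \<in> ?K \<longrightarrow> norm (F (r n) x - g x) < e"
  proof (rule Arzela_Ascoli[OF K, of F "R + ?n * R"])
    have vec: "norm (\<chi> i. c i) \<le> ?n * B" if "\<And>i. \<bar>c i\<bar> \<le> B" for c :: "'n \<Rightarrow> real" and B
    proof -
      have "norm (\<chi> i. c i) \<le> (\<Sum>i\<in>UNIV. \<bar>c i\<bar>)"
        using norm_le_l1_cart[of "\<chi> i. c i"] by simp
      also have "\<dots> \<le> ?n * B"
        using sum_bounded_above[of UNIV "\<lambda>i. \<bar>c i\<bar>" B] that by simp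
      finally show ?thesis .
    qed
    show "norm (F n x) \<le> R + ?n * R" if "x \<in> ?K" for n x
    proof -
      have x: "x \<in> U" using that U(4) by blast
      have "norm (F n x) \<le> norm (\<gamma> n x) + norm (\<chi> i. partial i (\<gamma> n) x)"
        unfolding F_def by (rule norm_Pair_le)
      also have "\<dots> \<le> R + ?n * R"
        using D(3)[OF x] vec[OF D(4)[OF x]] by (intro add_mono) auto
      finally show ?thesis .
    qed
    show "\<exists>d>0. \<forall>n y. y \<in> ?K \<and> norm (x - y) < d \<longrightarrow> norm (F n x - F n y) < e"
      if x: "x \<in> ?K" and e: "0 < e" for x e
    proof -
      obtain \<rho> where \<rho>: "0 < \<rho>" "ball x \<rho> \<subseteq> U"
        using U(1,4) x by (meson openE subsetD)
      have n: "0 < ?n" by simp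
      \<comment> \<open>\<open>d1\<close> serves the Lipschitz bound for the functions, \<open>d2\<close> the Hoelder bound for the partial
        derivatives; each gets half of \<open>e\<close>.\<close>
      define d1 where "d1 = e / (2 * ?n * R)"
      have d1: "0 < d1" using e n R by (simp add: d1_def)
      define d2 where "d2 = d1 powr (1 / \<alpha>)"
      have d2: "0 < d2" using d1 by (simp add: d2_def)
      define d where "d = min \<rho> (min d1 d2)"
      have d: "0 < d" using \<rho> d1 d2 by (simp add: d_def)
      have "norm (F n x - F n y) < e" if y: "y \<in> ?K" "norm (x - y) < d" for n y
      proof (cases "x = y")
        case True
        then show ?thesis using e by simp
      next
        case False
        have xy: "x \<in> ball x \<rho>" "y \<in> ball x \<rho>" "x \<in> U" "y \<in> U"
          using y \<rho> x U(4) by (auto simp: d_def dist_norm)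
        have "\<bar>\<gamma> n x - \<gamma> n y\<bar> \<le> ?n * R * norm (x - y)"
          by (rule bounded_partials_imp_Lipschitz_on_ball[of x \<rho>]) (use \<rho>(2) D(2,4) xy in auto)
        also have "\<dots> < ?n * R * d1"
          using y(2) R n by (intro mult_strict_left_mono) (auto simp: d_def)
        also have "\<dots> = e / 2" using R by (simp add: d1_def)
        finally have 1: "\<bar>\<gamma> n x - \<gamma> n y\<bar> < e / 2" .
        have "\<bar>partial i (\<gamma> n) x - partial i (\<gamma> n) y\<bar> \<le> R * d1" for i
        proof -
          have "\<bar>partial i (\<gamma> n) x - partial i (\<gamma> n) y\<bar> \<le> R * dist x y powr \<alpha>"
            using D(5)[OF xy(3,4) False, of i n] False by (simp add: pos_divide_le_eq)
          also have "\<dots> \<le> R * d2 powr \<alpha>"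
            using y(2) R \<alpha> by (intro mult_left_mono powr_mono2) (auto simp: d_def dist_norm)
          also have "d2 powr \<alpha> = d1" using \<alpha> d1 by (simp add: d2_def powr_powr)
          finally show ?thesis .
        qed
        from vec[OF this] have "norm (\<chi> i. partial i (\<gamma> n) x - partial i (\<gamma> n) y) \<le> ?n * (R * d1)" .
        also have "?n * (R * d1) = e / 2" using R by (simp add: d1_def)
        finally have 2: "norm (\<chi> i. partial i (\<gamma> n) x - partial i (\<gamma> n) y) \<le> e / 2" .
        have "F n x - F n y = (\<gamma> n x - \<gamma> n y, \<chi> i. partial i (\<gamma> n) x - partial i (\<gamma> n) y)"
          by (simp add: F_def vec_eq_iff)
        then have "norm (F n x - F n y) \<le> norm (\<gamma> n x - \<gamma> n y) + norm (\<chi> i. partial i (\<gamma> n) x - partial i (\<gamma> n) y)"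
          by (simp only: norm_Pair_le)
        with 1 2 show ?thesis by simp
      qed
      then show ?thesis using d by blast
    qed
  qed blast
  \<comment> \<open>The limit function and the limits of the partial derivatives, continued by \<open>1\<close> and \<open>0\<close> to the
    whole space, where they turn out to be continuous.\<close>
  define l where "l x = (if x \<in> ?K then fst (g x) else 1)" for x
  define G where "G i x = (if x \<in> ?K then snd (g x) $ i else 0)" for i x
  have close: "\<exists>N. \<forall>n\<ge>N. \<forall>x\<in>U. \<bar>\<gamma> (r n) x - l x\<bar> \<le> e \<and> (\<forall>i. \<bar>partial i (\<gamma> (r n)) x - G i x\<bar> \<le> e)"
    if e: "0 < e" for e
  proof -
    obtain N where N: "\<And>n x. n \<ge> N \<Longrightarrow> x \<in> ?K \<Longrightarrow> norm (F (r n) x - g x) < e"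
      using unif[OF e] by blast
    have "\<bar>\<gamma> (r n) x - l x\<bar> \<le> e \<and> (\<forall>i. \<bar>partial i (\<gamma> (r n)) x - G i x\<bar> \<le> e)"
      if n: "n \<ge> N" and x: "x \<in> U" for n x
    proof (cases "x \<in> ?K")
      case True
      have proj: "norm (fst z) \<le> norm z" "norm (snd z) \<le> norm z" for z :: "real \<times> (real^'n)"
        using norm_fst_le[of "fst z" "snd z"] norm_snd_le[of "snd z" "fst z"]
        unfolding prod.collapse by this+
      have lt: "norm (fst (F (r n) x - g x)) < e" "norm (snd (F (r n) x - g x)) < e"
        by (rule order_le_less_trans[OF proj(1) N[OF n True]], rule order_le_less_trans[OF proj(2) N[OF n True]])
      have "\<bar>fst (F (r n) x - g x)\<bar> \<le> e"
        using lt(1) unfolding real_norm_def by (rule less_imp_le)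
      moreover have "\<bar>snd (F (r n) x - g x) $ i\<bar> \<le> e" for i
        using component_le_norm_cart[of "snd (F (r n) x - g x)" i] lt(2) by linarith
      ultimately show ?thesis
        using True by (simp add: F_def l_def G_def)
    next
      case False
      then show ?thesis
        using D(6,7)[of x] x e by (simp add: l_def G_def)
    qed
    then show ?thesis by blast
  qed
  have lim: "(\<lambda>n. \<gamma> (r n) x) \<longlonglongrightarrow> l x" "(\<lambda>n. partial i (\<gamma> (r n)) x) \<longlonglongrightarrow> G i x" if x: "x \<in> U" for x i
  proof -
    show "(\<lambda>n. \<gamma> (r n) x) \<longlonglongrightarrow> l x"
    proof (rule LIMSEQ_I)
      fix e :: real assume "0 < e"
      then obtain N where "\<forall>n\<ge>N. \<forall>x\<in>U. \<bar>\<gamma> (r n) x - l x\<bar> \<le> e / 2"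
        using close[of "e / 2"] by fastforce
      then show "\<exists>N. \<forall>n\<ge>N. norm (\<gamma> (r n) x - l x) < e"
        using x \<open>0 < e\<close> by (intro exI[of _ N]) fastforce
    qed
    show "(\<lambda>n. partial i (\<gamma> (r n)) x) \<longlonglongrightarrow> G i x"
    proof (rule LIMSEQ_I)
      fix e :: real assume "0 < e"
      then obtain N where "\<forall>n\<ge>N. \<forall>x\<in>U. \<bar>partial i (\<gamma> (r n)) x - G i x\<bar> \<le> e / 2"
        using close[of "e / 2"] by fastforce
      then show "\<exists>N. \<forall>n\<ge>N. norm (partial i (\<gamma> (r n)) x - G i x) < e"
        using x \<open>0 < e\<close> by (intro exI[of _ N]) fastforce
    qed
  qed
  have deriv: "(l has_derivative (\<lambda>u. \<Sum>i\<in>UNIV. u $ i * G i x)) (at x)" if x: "x \<in> U" for x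
  proof -
    obtain \<rho> where \<rho>: "0 < \<rho>" "ball x \<rho> \<subseteq> U"
      using U(1) x by (meson openE)
    have xb: "x \<in> ball x \<rho>" using \<rho>(1) by simp
    have "\<exists>h. \<forall>y\<in>ball x \<rho>. (\<lambda>n. \<gamma> (r n) y) \<longlonglongrightarrow> h y \<and>
        (h has_derivative (\<lambda>u. \<Sum>i\<in>UNIV. u $ i * G i y)) (at y within ball x \<rho>)"
    proof (rule has_derivative_sequence[where ?x0.0 = x and l = "l x"
          and f' = "\<lambda>n y u. \<Sum>i\<in>UNIV. u $ i * partial i (\<gamma> (r n)) y"])
      show "convex (ball x \<rho>)" "x \<in> ball x \<rho>" "(\<lambda>n. \<gamma> (r n) x) \<longlonglongrightarrow> l x"
        using xb lim(1)[OF x] by auto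
      show "(\<gamma> (r n) has_derivative (\<lambda>u. \<Sum>i\<in>UNIV. u $ i * partial i (\<gamma> (r n)) y)) (at y within ball x \<rho>)"
        if "y \<in> ball x \<rho>" for n y
      proof -
        have "\<gamma> (r n) differentiable (at y)" using D(2) that \<rho>(2) by blast
        then have "(\<gamma> (r n) has_derivative frechet_derivative (\<gamma> (r n)) (at y)) (at y)"
          by (simp add: frechet_derivative_works)
        moreover have "frechet_derivative (\<gamma> (r n)) (at y) = (\<lambda>u. \<Sum>i\<in>UNIV. u $ i * partial i (\<gamma> (r n)) y)"
          by (rule ext) (rule frechet_derivative_eq_sum_partial[OF \<open>\<gamma> (r n) differentiable (at y)\<close>])
        ultimately show ?thesis
          by (metis has_derivative_at_withinI)
      qed
      show "\<forall>\<^sub>F n in sequentially. \<forall>y\<in>ball x \<rho>. \<forall>u.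
          norm ((\<Sum>i\<in>UNIV. u $ i * partial i (\<gamma> (r n)) y) - (\<Sum>i\<in>UNIV. u $ i * G i y)) \<le> e * norm u"
        if e: "0 < e" for e
      proof -
        have "0 < e / ?n" using e by simp
        from close[OF this] obtain N where
          N: "\<And>n y i. n \<ge> N \<Longrightarrow> y \<in> U \<Longrightarrow> \<bar>partial i (\<gamma> (r n)) y - G i y\<bar> \<le> e / ?n"
          by blast
        show ?thesis
          unfolding eventually_sequentially
        proof (intro exI[of _ N] allI impI ballI)
          fix n y and u :: "real^'n" assume n: "N \<le> n" and y: "y \<in> ball x \<rho>"
          have "\<bar>\<Sum>i\<in>UNIV. u $ i * (partial i (\<gamma> (r n)) y - G i y)\<bar> \<le> ?n * (e / ?n) * norm u"
            by (rule abs_sum_components_le) (use N[OF n] y \<rho>(2) in blast)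
          then show "norm ((\<Sum>i\<in>UNIV. u $ i * partial i (\<gamma> (r n)) y) - (\<Sum>i\<in>UNIV. u $ i * G i y)) \<le> e * norm u"
            by (simp add: right_diff_distrib sum_subtractf)
        qed
      qed
    qed
    then obtain h where h: "\<And>y. y \<in> ball x \<rho> \<Longrightarrow> (\<lambda>n. \<gamma> (r n) y) \<longlonglongrightarrow> h y"
        "(h has_derivative (\<lambda>u. \<Sum>i\<in>UNIV. u $ i * G i x)) (at x within ball x \<rho>)"
      using xb by blast
    have hl: "h y = l y" if "y \<in> ball x \<rho>" for y
      using LIMSEQ_unique[OF h(1)[OF that] lim(1)] that \<rho>(2) by blast
    have "(h has_derivative (\<lambda>u. \<Sum>i\<in>UNIV. u $ i * G i x)) (at x)"
      using h(2) unfolding at_within_open[OF xb open_ball] .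
    then show ?thesis
      by (rule has_derivative_transform_within_open[OF _ open_ball xb hl])
  qed
  have fd: "frechet_derivative l (at x) = (\<lambda>u. \<Sum>i\<in>UNIV. u $ i * G i x)" if "x \<in> U" for x
    using frechet_derivative_at[OF deriv[OF that]] by simp
  have pl: "partial i l x = G i x" if "x \<in> U" for i x
  proof -
    have "partial i l x = (\<Sum>j\<in>UNIV. if j = i then G j x else 0)"
      unfolding partial_def fd[OF that] by (intro sum.cong) (auto simp: axis_def)
    then show ?thesis by simp
  qed
  have holder: "\<bar>G i x - G i y\<bar> / dist x y powr \<alpha> \<le> R" if "x \<in> U" "y \<in> U" "x \<noteq> y" for i x y
    using that D(5)
    by (intro LIMSEQ_le_const2[of "\<lambda>n. \<bar>partial i (\<gamma> (r n)) x - partial i (\<gamma> (r n)) y\<bar> / dist x y powr \<alpha>"]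
        tendsto_intros lim) auto
  have open_cover: "continuous_on UNIV f" if "continuous_on U f" "continuous_on (- ?K) f" for f :: "real^'n \<Rightarrow> real"
  proof -
    have "continuous_on (U \<union> - ?K) f"
      using that U(1) by (intro continuous_on_open_Un) auto
    moreover have "U \<union> - ?K = UNIV" using U(4) by auto
    ultimately show ?thesis by simp
  qed
  have cl: "continuous_on UNIV l"
  proof (rule open_cover)
    show "continuous_on U l"
      using deriv by (intro continuous_at_imp_continuous_on) (auto intro: has_derivative_continuous)
    show "continuous_on (- ?K) l"
      by (rule continuous_on_eq[of _ "\<lambda>x. 1"]) (auto simp: l_def)
  qed
  have cG: "continuous_on UNIV (G i)" for i
  proof (rule open_cover)
    show "continuous_on (- ?K) (G i)"
      by (rule continuous_on_eq[of _ "\<lambda>x. 0"]) (auto simp: G_def)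
    show "continuous_on U (G i)"
      unfolding continuous_on_def
    proof
      fix x assume x: "x \<in> U"
      have "((\<lambda>y. R * dist x y powr \<alpha>) \<longlongrightarrow> R * dist x x powr \<alpha>) (at x within U)"
        using \<alpha> by (intro tendsto_mult tendsto_const tendsto_powr' tendsto_dist tendsto_ident_at) auto
      then have "((\<lambda>y. R * dist x y powr \<alpha>) \<longlongrightarrow> 0) (at x within U)"
        using \<alpha> by simp
      moreover have "\<forall>\<^sub>F y in at x within U. norm (G i y - G i x) \<le> R * dist x y powr \<alpha>"
      proof -
        have "norm (G i y - G i x) \<le> R * dist x y powr \<alpha>" if "y \<in> U" "y \<noteq> x" for y
          using holder[OF x that(1), of i] that(2) by (simp add: pos_divide_le_eq abs_minus_commute)
        then show ?thesis by (auto simp: eventually_at_filter)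
      qed
      ultimately have "((\<lambda>y. G i y - G i x) \<longlongrightarrow> 0) (at x within U)"
        by (rule Lim_null_comparison[rotated])
      then show "(G i \<longlongrightarrow> G i x) (at x within U)"
        by (simp add: LIM_zero_iff)
    qed
  qed
  have norm_le: "C1_holder_norm \<alpha> U l \<le> ereal R"
    unfolding C1_holder_norm_le_iff
  proof (intro conjI ballI allI impI)
    show "\<bar>l x\<bar> \<le> R" if "x \<in> U" for x
      using D(3)[OF that] by (intro LIMSEQ_le_const2[OF tendsto_rabs[OF lim(1)[OF that]]]) auto
    show "\<bar>partial i l x\<bar> \<le> R" if "x \<in> U" for i x
      unfolding pl[OF that]
      using D(4)[OF that] by (intro LIMSEQ_le_const2[OF tendsto_rabs[OF lim(2)[OF that]]]) auto
    show "\<bar>partial i l x - partial i l y\<bar> / dist x y powr \<alpha> \<le> R" if "x \<in> U" "y \<in> U" "x \<noteq> y" for i x y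
      using holder[OF that] by (simp add: pl that)
  qed
  have C1: "l \<in> C1_holder \<alpha> U"
    unfolding C1_holder_def
  proof (intro CollectI conjI allI)
    show "Ck_on 1 U l"
    proof -
      have "continuous_on U (\<lambda>x. frechet_derivative l (at x) u)" for u
      proof (rule continuous_on_eq)
        show "continuous_on U (\<lambda>x. \<Sum>i\<in>UNIV. u $ i * G i x)"
          by (intro continuous_on_sum continuous_on_mult continuous_on_const continuous_on_subset[OF cG]) auto
      qed (simp add: fd)
      moreover have "\<forall>x\<in>U. l differentiable (at x)"
        using deriv by (auto simp: differentiable_def)
      ultimately show ?thesis by (simp add: One_nat_def)
    qed
    show "extends_continuously U l"
      unfolding extends_continuously_def
      using continuous_on_subset[OF cl subset_UNIV] by blast
    show "extends_continuously U (partial i l)" for i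
      unfolding extends_continuously_def
      using continuous_on_subset[OF cG subset_UNIV] pl by (metis (no_types))
    show "C1_holder_norm \<alpha> U l < \<infinity>"
      using norm_le by (rule order_le_less_trans) simp
  qed
  have Us: "U \<in> sets lebesgue" "V \<in> sets lebesgue" using U by auto
  have ae: "AE x in lebesgue_on U. (\<lambda>n. \<gamma> (r n) x) \<longlonglongrightarrow> l x"
    using lim(1) by (intro AE_I2) auto
  have "l \<in> borel_measurable (lebesgue_on U)"
    by (intro continuous_imp_measurable_on_sets_lebesgue Us continuous_on_subset[OF cl]) auto
  then have "l \<in> Gam' m M U V"
    using Gam'_AE_limit[OF Us m _ _ ae] D(1) by blast
  then have "l \<in> X_C1 \<alpha> m M U V R"
    using C1 norm_le by (simp add: X_C1_def)
  then show ?thesis using r ae by blast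
qed

section \<open>Compactness of the coefficient classes\<close>

theorem lemma4p5:
  fixes \<Omega> \<Omega>' :: "(real^'n) set" and m M R \<alpha> p :: real
  assumes "2 \<le> CARD('n)"
    and "open \<Omega>" and "connected \<Omega>" and "\<Omega> \<noteq> {}" and "bounded \<Omega>" and "smooth_boundary \<Omega>"
    and "open \<Omega>'" and "connected \<Omega>'" and "closure \<Omega>' \<subseteq> \<Omega>"
    and "0 < m" and "max 1 m \<le> M" and "0 < R" and "0 < \<alpha>" and "\<alpha> \<le> 1"
    and "1 \<le> p"
  shows "compactin (Lp_topology p \<Omega>) (X_d \<alpha> m M \<Omega> \<Omega>' R // ae_eq \<Omega>)"
proof (rule AE_subsequences_imp_compactin_Lp[where M = M])
  show "\<Omega> \<in> lmeasurable"
    using assms by (auto intro: lmeasurable_open)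
  have G: "f \<in> Gam' m M \<Omega> \<Omega>'" if "f \<in> X_d \<alpha> m M \<Omega> \<Omega>' R" for f
    using that by (auto simp: X_d_def X_BV_def X_C1_def split: if_splits)
  show "f \<in> borel_measurable (lebesgue_on \<Omega>)" "AE x in lebesgue_on \<Omega>. \<bar>f x\<bar> \<le> M"
    if "f \<in> X_d \<alpha> m M \<Omega> \<Omega>' R" for f
    using Gam'_measurable[OF G[OF that]] Gam'_abs_le[OF G[OF that]] assms by blast+
  show "\<exists>l\<in>X_d \<alpha> m M \<Omega> \<Omega>' R. \<exists>r. strict_mono (r :: nat \<Rightarrow> nat) \<and>
      (AE x in lebesgue_on \<Omega>. (\<lambda>n. f (r n) x) \<longlonglongrightarrow> l x)"
    if f: "\<And>n. f n \<in> X_d \<alpha> m M \<Omega> \<Omega>' R" for f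
  proof (cases "CARD('n) = 2")
    case True
    then show ?thesis
      using X_BV_AE_convergent_subsequence[of \<Omega> \<Omega>' m M R f] f assms by (simp add: X_d_def)
  next
    case False
    then show ?thesis
      using X_C1_AE_convergent_subsequence[of \<Omega> \<Omega>' m R \<alpha> f M] f assms by (simp add: X_d_def)
  qed
qed (fact assms(15))

end
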